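(* For every $d\in\mathbb{N}$ the multiple Rademacher system $\{\mathrm{r}^{\otimes}_{\vec j}\}_{\vec j\in\mathbb{N}^d}$ has the random unconditional convergence (RUC) property in $L_\infty([0,1]^d)$: there is a constant $C_d>0$ depending only on $d$ such that for all $n\in\mathbb{N}$ and $a_{\vec j}\in\mathbb{R}$, $\vec j\in\mathbb{N}_n^d$, $$ \mathsf{E}_\theta\Big\|\sum_{\vec j\in\mathbb{N}_n^d}\theta_{\vec j}\,a_{\vec j}\,\mathrm{r}^{\otimes}_{\vec j}\Big\|_{L_\infty([0,1]^d)}\le C_d\Big\|\sum_{\vec j\in\mathbb{N}_n^d}a_{\vec j}\,\mathrm{r}^{\otimes}_{\vec j}\Big\|_{L_\infty([0,1]^d)}. $$ More precisely, there is a constant $c_d>0$ depending only on $d$ such that for all $n\in\mathbb{N}$ and $a_{\vec j}\in\mathbb{R}$, $\vec j\in\mathbb{N}_n^d$, $$ \Big\|\sum_{\vec j\in\mathbb{N}_n^d}a_{\vec j}\,\mathrm{r}^{\otimes}_{\vec j}\Big\|_{L_\infty([0,1]^d)}\ge c_d\max_{1\le k\le d}\ \sum_{l=1}^n\Big(\sum_{\vec j\in\mathbb{N}_n^d(k,l)}a_{\vec j}^2\Big)^{1/2} $$ and $$ \mathsf{E}_\theta\Big\|\sum_{\vec j\in\mathbb{N}_n^d}a_{\vec j}\,\theta_{\vec j}\,\mathrm{r}^{\otimes}_{\vec j}\Big\|_{L_\infty([0,1]^d)}\le \sum_{k=1}^d 2^{d-k}\sum_{l=1}^n\Big(\sum_{\vec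 j\in\mathbb{N}_n^d(k,l)}a_{\vec j}^2\Big)^{1/2}. $$
   Context: The Rademacher functions are $r_i(t)=(-1)^{[2^i t]}$, $t\in[0,1]$, $i=1,2,\dots$, where $[x]$ is the integer part of $x$. For $\vec j=(j_1,\dots,j_d)\in\mathbb{N}^d$ and $\vec t=(t_1,\dots,t_d)\in[0,1]^d$, $\mathrm{r}^{\otimes}_{\vec j}(\vec t)=r_{j_1}(t_1)r_{j_2}(t_2)\cdots r_{j_d}(t_d)$. Further, $\mathbb{N}_n^d=\{1,\dots,n\}^d$ and, for $k\in\{1,\dots,d\}$, $l\in\{1,\dots,n\}$, $\mathbb{N}_n^d(k,l)=\{\vec j\in\mathbb{N}_n^d: j_k=l\}$. $\mathsf{E}_\theta$ denotes the expectation (uniform average) over all arrangements of signs $\theta_{\vec j}=\pm1$, $\vec j\in\mathbb{N}_n^d$. *)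

theory Defs
  imports "HOL-Probability.Probability"
begin

definition rademacher :: "nat \<Rightarrow> real \<Rightarrow> real" where
  "rademacher i t = (- 1) powi \<lfloor>2 ^ i * t\<rfloor>"

text \<open>
  Since the dimension \<open>d\<close> is a number and not a type, a multi-index and a point of the cube
  are functions on \<open>nat\<close> of which only the values at \<open>1, \<dots>, d\<close> matter; elsewhere they are
  \<open>undefined\<close>, as usual for \<open>PiE\<close> and \<open>PiM\<close>.
\<close>

definition multi_rademacher :: "nat \<Rightarrow> (nat \<Rightarrow> nat) \<Rightarrow> (nat \<Rightarrow> real) \<Rightarrow> real" where
  "multi_rademacher d j t = (\<Prod>k = 1..d. rademacher (j k) (t k))"

definition multi_indices :: "nat \<Rightarrow> nat \<Rightarrow> (nat \<Rightarrow> nat) set" where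
  "multi_indices d n = {1..d} \<rightarrow>\<^sub>E {1..n}"

definition multi_indices_section :: "nat \<Rightarrow> nat \<Rightarrow> nat \<Rightarrow> nat \<Rightarrow> (nat \<Rightarrow> nat) set" where
  "multi_indices_section d n k l = {j \<in> multi_indices d n. j k = l}"

definition multi_rademacher_sum ::
    "nat \<Rightarrow> nat \<Rightarrow> ((nat \<Rightarrow> nat) \<Rightarrow> real) \<Rightarrow> (nat \<Rightarrow> real) \<Rightarrow> real" where
  "multi_rademacher_sum d n a t = (\<Sum>j \<in> multi_indices d n. a j * multi_rademacher d j t)"

definition unit_cube_measure :: "nat \<Rightarrow> (nat \<Rightarrow> real) measure" where
  "unit_cube_measure d = (\<Pi>\<^sub>M k \<in> {1..d}. restrict_space lborel {0..1})"

text \<open>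
  The conversion to \<open>real\<close> would turn an infinite essential supremum into \<open>0\<close>; the lemma
  \<open>esssup_multi_rademacher_sum\<close> below shows that this does not occur for the sums considered here.
\<close>

definition Linf_norm :: "'a measure \<Rightarrow> ('a \<Rightarrow> real) \<Rightarrow> real" where
  "Linf_norm M f = real_of_ereal (esssup M (\<lambda>x. ereal \<bar>f x\<bar>))"

abbreviation Linf_cube :: "nat \<Rightarrow> ((nat \<Rightarrow> real) \<Rightarrow> real) \<Rightarrow> real" where
  "Linf_cube d \<equiv> Linf_norm (unit_cube_measure d)"

definition sign_arrangements :: "nat \<Rightarrow> nat \<Rightarrow> ((nat \<Rightarrow> nat) \<Rightarrow> real) set" where
  "sign_arrangements d n = multi_indices d n \<rightarrow>\<^sub>E {- 1, 1}"

definition sign_expectation :: "nat \<Rightarrow> nat \<Rightarrow> (((nat \<Rightarrow> nat) \<Rightarrow> real) \<Rightarrow> real) \<Rightarrow> real" where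
  "sign_expectation d n F = measure_pmf.expectation (pmf_of_set (sign_arrangements d n)) F"

lemma sign_expectation_eq_average:
  "sign_expectation d n F =
     (\<Sum>\<theta> \<in> sign_arrangements d n. F \<theta>) / real (card (sign_arrangements d n))"
proof -
  have "finite (sign_arrangements d n)"
    by (simp add: sign_arrangements_def multi_indices_def finite_PiE)
  moreover have "sign_arrangements d n \<noteq> {}"
    by (simp add: sign_arrangements_def PiE_eq_empty_iff)
  ultimately show ?thesis
    by (simp add: sign_expectation_def integral_pmf_of_set)
qed

lemma abs_rademacher: "\<bar>rademacher i t\<bar> = 1"
  by (simp add: rademacher_def power_int_abs)

lemma abs_multi_rademacher: "\<bar>multi_rademacher d j t\<bar> = 1"
  by (simp add: multi_rademacher_def abs_prod abs_rademacher)

lemma measurable_rademacher [measurable]: "rademacher i \<in> borel_measurable borel"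
  unfolding rademacher_def[abs_def] by measurable

lemma measurable_multi_rademacher_sum:
  "multi_rademacher_sum d n a \<in> borel_measurable (unit_cube_measure d)"
proof -
  have "(\<lambda>t. rademacher i (t k)) \<in> borel_measurable (unit_cube_measure d)" if "k \<in> {1..d}" for i k
  proof -
    have "(\<lambda>t. t k) \<in> unit_cube_measure d \<rightarrow>\<^sub>M restrict_space lborel {0..1}"
      unfolding unit_cube_measure_def using that by (rule measurable_component_singleton)
    moreover have "rademacher i \<in> borel_measurable (restrict_space lborel {0..1})"
      by (rule measurable_restrict_space1) simp
    ultimately show ?thesis
      by (rule measurable_compose)
  qed
  then show ?thesis
    unfolding multi_rademacher_sum_def[abs_def] multi_rademacher_def
    by (intro borel_measurable_sum borel_measurable_times borel_measurable_prod) auto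
qed

lemma esssup_multi_rademacher_sum:
  "esssup (unit_cube_measure d) (\<lambda>t. ereal \<bar>multi_rademacher_sum d n a t\<bar>) =
     ereal (Linf_cube d (multi_rademacher_sum d n a))"
proof -
  let ?M = "unit_cube_measure d" and ?f = "\<lambda>t. ereal \<bar>multi_rademacher_sum d n a t\<bar>"
  note [measurable] = measurable_multi_rademacher_sum
  interpret I: prob_space "restrict_space lborel {0..1::real}"
    by (rule prob_spaceI) (simp add: emeasure_restrict_space space_restrict_space)
  interpret M: prob_space ?M
    unfolding unit_cube_measure_def by (intro prob_space_PiM I.prob_space_axioms)
  have "\<bar>multi_rademacher_sum d n a t\<bar> \<le> (\<Sum>j \<in> multi_indices d n. \<bar>a j\<bar>)" for t
    unfolding multi_rademacher_sum_def
    by (rule order_trans[OF sum_abs]) (simp add: abs_mult abs_multi_rademacher)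
  then have "esssup ?M ?f \<le> ereal (\<Sum>j \<in> multi_indices d n. \<bar>a j\<bar>)"
    by (intro esssup_I) auto
  moreover have "0 \<le> esssup ?M ?f"
  proof -
    have "esssup ?M (\<lambda>_. 0 :: ereal) \<le> esssup ?M ?f"
      by (rule esssup_mono) auto
    then show ?thesis
      by (simp add: esssup_const M.emeasure_space_1)
  qed
  ultimately show ?thesis
    unfolding Linf_norm_def by (cases "esssup ?M ?f") auto
qed

end

theory Submission
  imports Defs
begin

text \<open>
  On a cell of the cube the Rademacher functions \<open>r\<^sub>1, \<dots>, r\<^sub>n\<close> of the \<open>d\<close> coordinates are constant, every
  pattern of signs \<open>\<epsilon> (k, l)\<close>, \<open>k \<le> d\<close>, \<open>l \<le> n\<close>, occurs on some cell, and cells have positive measure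
  (\<open>rademacher_cell_positive_measure\<close>). So the norm of \<open>\<Sum> a j r j\<close> is the maximum over all \<open>\<epsilon>\<close> of
  \<open>\<bar>\<Sum> a j \<Prod> \<epsilon> (k, j k)\<bar>\<close>, and the theorem is about finitely many signs. The unconditional estimate
  follows by comparing the two explicit bounds, which share the quantities
  \<open>R k = (\<Sum> l. sqrt (\<Sum> j with j k = l. (a j)\<^sup>2))\<close>.

  Lower bound (\<open>Linf_cube_lower_bound\<close>). Fix \<open>k\<close>. Choosing the signs \<open>\<epsilon> (k, l)\<close> optimally turns the
  sum into \<open>\<Sum> l. \<bar>Y l\<bar>\<close>, where \<open>Y l\<close> is the part with \<open>j k = l\<close>, a polynomial of degree \<open>d - 1\<close> in the
  other signs. Averaging over these signs leaves the Khintchine inequality \<open>walsh_khintchine\<close> for such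
  polynomials, a consequence of the comparison \<open>bonami_fourth_moment\<close> of fourth and second moments.

  Upper bound (\<open>sign_mean_MAX_multi_sum\<close>). Induction on \<open>d\<close>: maximising over the signs of the last
  coordinate gives \<open>\<Sum> l. \<bar>X l\<bar>\<close> with \<open>X l\<close> the part with last index \<open>l\<close>. The mean of \<open>\<bar>X l\<bar>\<close> is bounded
  by the square function, which is the term of weight one. The fluctuation of \<open>\<Sum> l. \<bar>X l\<bar>\<close> is
  symmetrised with one sign per \<open>l\<close>, at the price of a factor 2; the contraction principle then removes
  the absolute values, and the new signs are absorbed into \<open>\<theta>\<close> (\<open>sign_mean_MAX_block_abs\<close>). What remains
  is a random sum over \<open>d - 1\<close> coordinates with random coefficients \<open>\<Sum> l. \<theta> (i, l) a (i, l)\<close>, to which the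
  induction hypothesis applies. Since each coordinate costs one factor 2, the weights are \<open>2 ^ (d - k)\<close>.
\<close>

section \<open>Averages over signs\<close>

text \<open>
  The value outside \<open>V\<close> is \<open>1\<close> and not \<open>undefined\<close>, so that sign families form a group under pointwise
  multiplication and \<open>signs V \<subseteq> signs W\<close> for \<open>V \<subseteq> W\<close>.
\<close>

definition signs :: "'a set \<Rightarrow> ('a \<Rightarrow> real) set" where
  "signs V = {\<theta>. (\<forall>v. \<theta> v \<in> {-1, 1}) \<and> (\<forall>v. v \<notin> V \<longrightarrow> \<theta> v = 1)}"

definition sign_mean :: "'a set \<Rightarrow> (('a \<Rightarrow> real) \<Rightarrow> real) \<Rightarrow> real" where
  "sign_mean V F = (\<Sum>\<theta>\<in>signs V. F \<theta>) / card (signs V)"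

lemma signsI:
  assumes "\<And>v. \<theta> v = 1 \<or> \<theta> v = -1" "\<And>v. v \<notin> V \<Longrightarrow> \<theta> v = 1"
  shows "\<theta> \<in> signs V"
proof -
  have "\<theta> v \<in> {-1, 1}" for v
    using assms(1)[of v] by auto
  then show ?thesis
    using assms(2) by (simp add: signs_def)
qed

lemma signs_value: "\<theta> \<in> signs V \<Longrightarrow> \<theta> v = 1 \<or> \<theta> v = -1"
  by (auto simp: signs_def)

lemma signs_abs: "\<theta> \<in> signs V \<Longrightarrow> \<bar>\<theta> v\<bar> = 1"
  using signs_value[of \<theta> V v] by auto

lemma signs_outside: "\<theta> \<in> signs V \<Longrightarrow> v \<notin> V \<Longrightarrow> \<theta> v = 1"
  by (simp add: signs_def)

lemma signs_nonempty: "signs V \<noteq> {}"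
  by (auto simp: signs_def)

lemma signs_empty: "signs {} = {\<lambda>_. 1}"
  by (auto simp: signs_def)

lemma signs_insert:
  assumes "v \<notin> V"
  shows "signs (insert v V) = signs V \<union> (\<lambda>\<theta>. \<theta>(v := -1)) ` signs V"
proof (intro equalityI subsetI)
  fix \<theta> :: "'a \<Rightarrow> real" assume \<theta>: "\<theta> \<in> signs (insert v V)"
  show "\<theta> \<in> signs V \<union> (\<lambda>\<theta>. \<theta>(v := -1)) ` signs V"
  proof (cases "\<theta> v = 1")
    case True
    then show ?thesis using \<theta> by (auto simp: signs_def)
  next
    case False
    then have "\<theta> = (\<theta>(v := 1))(v := -1)" "\<theta>(v := 1) \<in> signs V"
      using \<theta> signs_value[OF \<theta>, of v] assms by (auto simp: signs_def)
    then show ?thesis by blast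
  qed
next
  fix \<theta> :: "'a \<Rightarrow> real" assume "\<theta> \<in> signs V \<union> (\<lambda>\<theta>. \<theta>(v := -1)) ` signs V"
  then obtain \<eta> where \<eta>: "\<eta> \<in> signs V" "\<theta> = \<eta> \<or> \<theta> = \<eta>(v := -1)"
    by blast
  show "\<theta> \<in> signs (insert v V)"
  proof (rule signsI)
    show "\<theta> u = 1 \<or> \<theta> u = -1" for u
      using \<eta>(2) signs_value[OF \<eta>(1), of u] by (cases "u = v") auto
    show "\<theta> u = 1" if "u \<notin> insert v V" for u
      using \<eta>(2) signs_outside[OF \<eta>(1), of u] that by auto
  qed
qed

lemma inj_on_flip_signs:
  assumes "v \<notin> V"
  shows "inj_on (\<lambda>\<theta>. \<theta>(v := -1)) (signs V)"
proof (rule inj_onI)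
  fix \<theta> \<eta> :: "'a \<Rightarrow> real"
  assume *: "\<theta> \<in> signs V" "\<eta> \<in> signs V" "\<theta>(v := -1) = \<eta>(v := -1)"
  show "\<theta> = \<eta>"
  proof
    fix u
    show "\<theta> u = \<eta> u"
      using signs_outside[OF *(1)] signs_outside[OF *(2)] fun_cong[OF *(3), of u] assms
      by (cases "u = v") auto
  qed
qed

lemma disjoint_flip_signs:
  assumes "v \<notin> V"
  shows "signs V \<inter> (\<lambda>\<theta>. \<theta>(v := -1)) ` signs V = {}"
proof -
  have "\<theta> v = 1" if "\<theta> \<in> signs V" for \<theta>
    using that assms by (rule signs_outside)
  then show ?thesis by fastforce
qed

lemma finite_signs: "finite V \<Longrightarrow> finite (signs V)"
  by (induction V rule: finite_induct) (auto simp: signs_empty signs_insert)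

lemma card_signs_pos: "finite V \<Longrightarrow> card (signs V) > 0"
  by (simp add: card_gt_0_iff finite_signs signs_nonempty)

lemma signs_mult: "\<theta> \<in> signs V \<Longrightarrow> \<eta> \<in> signs V \<Longrightarrow> (\<lambda>v. \<theta> v * \<eta> v) \<in> signs V"
proof (rule signsI)
  assume *: "\<theta> \<in> signs V" "\<eta> \<in> signs V"
  fix v
  show "\<theta> v * \<eta> v = 1 \<or> \<theta> v * \<eta> v = -1"
    using signs_value[OF *(1), of v] signs_value[OF *(2), of v] by auto
  assume "v \<notin> V"
  then show "\<theta> v * \<eta> v = 1"
    using signs_outside[OF *(1), of v] signs_outside[OF *(2), of v] by simp
qed

lemma sign_mean_insert:
  assumes "finite V" "v \<notin> V"
  shows "sign_mean (insert v V) F = (sign_mean V F + sign_mean V (\<lambda>\<theta>. F (\<theta>(v := -1)))) / 2"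
proof -
  note * = finite_signs[OF assms(1)] disjoint_flip_signs[OF assms(2)] inj_on_flip_signs[OF assms(2)]
  have "card (signs (insert v V)) = 2 * card (signs V)"
    using * by (simp add: signs_insert[OF assms(2)] card_Un_disjoint card_image)
  moreover have "(\<Sum>\<theta>\<in>signs (insert v V). F \<theta>)
      = (\<Sum>\<theta>\<in>signs V. F \<theta>) + (\<Sum>\<theta>\<in>signs V. F (\<theta>(v := -1)))"
    using * by (simp add: signs_insert[OF assms(2)] sum.union_disjoint sum.reindex)
  ultimately show ?thesis
    using card_signs_pos[OF assms(1)] by (simp add: sign_mean_def field_simps)
qed

lemma sign_mean_empty: "sign_mean {} F = F (\<lambda>_. 1)"
  by (simp add: sign_mean_def signs_empty)

lemma sign_mean_const: "finite V \<Longrightarrow> sign_mean V (\<lambda>_. c) = c"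
  using card_signs_pos[of V] by (simp add: sign_mean_def)

lemma sign_mean_add: "sign_mean V (\<lambda>\<theta>. F \<theta> + G \<theta>) = sign_mean V F + sign_mean V G"
  by (simp add: sign_mean_def sum.distrib add_divide_distrib)

lemma sign_mean_diff: "sign_mean V (\<lambda>\<theta>. F \<theta> - G \<theta>) = sign_mean V F - sign_mean V G"
  by (simp add: sign_mean_def sum_subtractf diff_divide_distrib)

lemma sign_mean_cmult: "sign_mean V (\<lambda>\<theta>. c * F \<theta>) = c * sign_mean V F"
  by (simp add: sign_mean_def sum_distrib_left)

lemma sign_mean_sum: "sign_mean V (\<lambda>\<theta>. \<Sum>i\<in>A. F i \<theta>) = (\<Sum>i\<in>A. sign_mean V (F i))"
  unfolding sign_mean_def by (subst sum.swap) (simp add: sum_divide_distrib)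

lemma sign_mean_mono: "(\<And>\<theta>. \<theta> \<in> signs V \<Longrightarrow> F \<theta> \<le> G \<theta>) \<Longrightarrow> sign_mean V F \<le> sign_mean V G"
  unfolding sign_mean_def by (intro divide_right_mono sum_mono) auto

lemma sign_mean_cong: "(\<And>\<theta>. \<theta> \<in> signs V \<Longrightarrow> F \<theta> = G \<theta>) \<Longrightarrow> sign_mean V F = sign_mean V G"
  unfolding sign_mean_def by simp

lemma sign_mean_swap:
  "sign_mean V (\<lambda>\<theta>. sign_mean W (\<lambda>\<eta>. F \<theta> \<eta>)) = sign_mean W (\<lambda>\<eta>. sign_mean V (\<lambda>\<theta>. F \<theta> \<eta>))"
proof -
  have "(\<Sum>\<theta>\<in>signs V. \<Sum>\<eta>\<in>signs W. F \<theta> \<eta>) = (\<Sum>\<eta>\<in>signs W. \<Sum>\<theta>\<in>signs V. F \<theta> \<eta>)"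
    by (rule sum.swap)
  then show ?thesis
    by (simp add: sign_mean_def sum_divide_distrib[symmetric] mult.commute)
qed

lemma sign_mean_translate:
  assumes "s \<in> signs V"
  shows "sign_mean V (\<lambda>\<theta>. F (\<lambda>v. s v * \<theta> v)) = sign_mean V F"
proof -
  have "s v * (s v * x) = x" for v x
    using signs_value[OF assms, of v] by auto
  then have "(\<Sum>\<theta>\<in>signs V. F (\<lambda>v. s v * \<theta> v)) = (\<Sum>\<theta>\<in>signs V. F \<theta>)"
    by (intro sum.reindex_bij_witness[where i = "\<lambda>\<theta> v. s v * \<theta> v" and j = "\<lambda>\<theta> v. s v * \<theta> v"])
      (auto intro: signs_mult assms)
  then show ?thesis by (simp add: sign_mean_def)
qed

text \<open>
  A random sign per block of a partition of \<open>J\<close> does not change the distribution of \<open>\<theta>\<close>: the product of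
  the two is again a uniformly distributed family of signs. The congruence premise says that \<open>F\<close> does not
  look at \<open>\<theta>\<close> outside \<open>J\<close>, where \<open>\<eta> (p j)\<close> need not be \<open>1\<close>.
\<close>

lemma sign_mean_randomize:
  assumes "finite L" "p ` J \<subseteq> L"
    and cong: "\<And>\<theta> \<theta>'. (\<And>j. j \<in> J \<Longrightarrow> \<theta> j = \<theta>' j) \<Longrightarrow> F \<theta> = F \<theta>'"
  shows "sign_mean J (\<lambda>\<theta>. sign_mean L (\<lambda>\<eta>. F (\<lambda>j. \<eta> (p j) * \<theta> j))) = sign_mean J F"
proof -
  have "sign_mean J (\<lambda>\<theta>. F (\<lambda>j. \<eta> (p j) * \<theta> j)) = sign_mean J F" if "\<eta> \<in> signs L" for \<eta>
  proof -
    define s where "s j = (if j \<in> J then \<eta> (p j) else 1)" for j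
    have "s \<in> signs J"
      using signs_value[OF that] by (auto simp: signs_def s_def)
    moreover have "F (\<lambda>j. \<eta> (p j) * \<theta> j) = F (\<lambda>j. s j * \<theta> j)" for \<theta>
      by (rule cong) (simp add: s_def)
    ultimately show ?thesis using sign_mean_translate[of s J F] by simp
  qed
  then have "sign_mean L (\<lambda>\<eta>. sign_mean J (\<lambda>\<theta>. F (\<lambda>j. \<eta> (p j) * \<theta> j))) = sign_mean J F"
    by (simp add: sign_mean_cong[of L _ "\<lambda>_. sign_mean J F"] sign_mean_const assms(1))
  then show ?thesis by (subst sign_mean_swap)
qed

text \<open>
  Two independent copies of \<open>\<theta>\<close> may be exchanged on any fixed part of the index set. This is the source
  of the new signs in the symmetrisation argument.
\<close>

lemma sign_mean_exchange:
  fixes P :: "'a \<Rightarrow> bool"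
  defines "mix \<equiv> \<lambda>\<theta> \<theta>' v. if P v then \<theta> v else \<theta>' v :: real"
  shows "sign_mean V (\<lambda>\<theta>. sign_mean V (\<lambda>\<theta>'. F (mix \<theta> \<theta>') (mix \<theta>' \<theta>)))
       = sign_mean V (\<lambda>\<theta>. sign_mean V (\<lambda>\<theta>'. F \<theta> \<theta>'))"
proof -
  have mix: "mix \<theta> \<theta>' \<in> signs V" if "\<theta> \<in> signs V" "\<theta>' \<in> signs V" for \<theta> \<theta>'
    using that by (auto simp: signs_def mix_def)
  have inv: "mix (mix \<theta> \<theta>') (mix \<theta>' \<theta>) = \<theta>" for \<theta> \<theta>'
    by (auto simp: mix_def)
  have "(\<Sum>(\<theta>, \<theta>')\<in>signs V \<times> signs V. F (mix \<theta> \<theta>') (mix \<theta>' \<theta>))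
      = (\<Sum>(\<theta>, \<theta>')\<in>signs V \<times> signs V. F \<theta> \<theta>')"
    by (rule sum.reindex_bij_witness[where i = "\<lambda>(\<theta>, \<theta>'). (mix \<theta> \<theta>', mix \<theta>' \<theta>)"
          and j = "\<lambda>(\<theta>, \<theta>'). (mix \<theta> \<theta>', mix \<theta>' \<theta>)"])
      (auto simp: inv mix)
  then show ?thesis
    by (simp add: sign_mean_def sum_divide_distrib[symmetric] sum.cartesian_product)
qed

text \<open>
  Jensen's inequality for the square root, from the nonnegativity of the variance.
\<close>

lemma sign_mean_sqrt_le:
  assumes "finite V" "\<And>\<theta>. \<theta> \<in> signs V \<Longrightarrow> Y \<theta> \<ge> 0"
  shows "sign_mean V (\<lambda>\<theta>. sqrt (Y \<theta>)) \<le> sqrt (sign_mean V Y)"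
proof -
  define m where "m = sign_mean V (\<lambda>\<theta>. sqrt (Y \<theta>))"
  have "sign_mean V (\<lambda>\<theta>. 2 * m * sqrt (Y \<theta>) - m\<^sup>2) \<le> sign_mean V Y"
  proof (rule sign_mean_mono)
    fix \<theta> assume "\<theta> \<in> signs V"
    then have "(sqrt (Y \<theta>))\<^sup>2 = Y \<theta>" using assms(2) by simp
    then show "2 * m * sqrt (Y \<theta>) - m\<^sup>2 \<le> Y \<theta>"
      using zero_le_power2[of "sqrt (Y \<theta>) - m"] by (simp add: power2_diff algebra_simps)
  qed
  then have "m\<^sup>2 \<le> sign_mean V Y"
    using assms(1) by (simp add: sign_mean_diff sign_mean_cmult sign_mean_const m_def[symmetric] power2_eq_square)
  then show ?thesis
    unfolding m_def[symmetric] by (rule real_le_rsqrt)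
qed

section \<open>The contraction principle\<close>

lemma MAX_le:
  fixes f :: "'a \<Rightarrow> 'b::linorder"
  assumes "finite T" "T \<noteq> {}" "\<And>t. t \<in> T \<Longrightarrow> f t \<le> c"
  shows "(MAX t\<in>T. f t) \<le> c"
  using assms by simp

lemma MAX_ge:
  fixes f :: "'a \<Rightarrow> 'b::linorder"
  assumes "finite T" "t \<in> T"
  shows "f t \<le> (MAX t\<in>T. f t)"
  using assms by simp

lemma MAX_attained:
  fixes f :: "'a \<Rightarrow> 'b::linorder"
  assumes "finite T" "T \<noteq> {}"
  obtains t where "t \<in> T" "(MAX t\<in>T. f t) = f t"
proof -
  have "Max (f ` T) \<in> f ` T"
    using assms by (intro Max_in) auto
  then show thesis using that by (elim imageE)
qed

text \<open>
  If \<open>t\<close> and \<open>s\<close> attain the two maxima on the left, then \<open>\<bar>v t\<bar> - \<bar>v s\<bar> \<le> \<bar>v t - v s\<bar>\<close>, so that \<open>t\<close> and \<open>s\<close>, in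
  one of the two orders, do at least as well on the right.
\<close>

lemma MAX_add_abs_diff_abs:
  fixes h v :: "'t \<Rightarrow> real"
  assumes "finite T" "T \<noteq> {}"
  shows "(MAX t\<in>T. h t + \<bar>v t\<bar>) + (MAX t\<in>T. h t - \<bar>v t\<bar>)
       \<le> (MAX t\<in>T. h t + v t) + (MAX t\<in>T. h t - v t)"
proof -
  obtain t where t: "t \<in> T" "(MAX t\<in>T. h t + \<bar>v t\<bar>) = h t + \<bar>v t\<bar>"
    using assms by (rule MAX_attained)
  obtain s where s: "s \<in> T" "(MAX t\<in>T. h t - \<bar>v t\<bar>) = h s - \<bar>v s\<bar>"
    using assms by (rule MAX_attained)
  note MAX_ge[OF assms(1) t(1), of "\<lambda>t. h t + v t"] MAX_ge[OF assms(1) t(1), of "\<lambda>t. h t - v t"]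
    MAX_ge[OF assms(1) s(1), of "\<lambda>t. h t + v t"] MAX_ge[OF assms(1) s(1), of "\<lambda>t. h t - v t"]
  then show ?thesis using t(2) s(2) by linarith
qed

text \<open>
  The absolute values are removed one at a time, by the preceding lemma with the average over the two
  values of a single sign. The summand \<open>g\<close> makes room in the induction for the terms already treated. It
  matters that the maximum is taken without an absolute value: the constant is then 1 and not 2.
\<close>

lemma sign_mean_contraction:
  fixes g :: "'t \<Rightarrow> real" and v :: "'l \<Rightarrow> 't \<Rightarrow> real"
  assumes "finite L" and T: "finite T" "T \<noteq> {}"
  shows "sign_mean L (\<lambda>\<eta>. MAX t\<in>T. g t + (\<Sum>l\<in>L. \<eta> l * \<bar>v l t\<bar>))
       \<le> sign_mean L (\<lambda>\<eta>. MAX t\<in>T. g t + (\<Sum>l\<in>L. \<eta> l * v l t))"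
  using assms(1)
proof (induction L arbitrary: g rule: finite_induct)
  case empty
  then show ?case by (simp add: sign_mean_empty)
next
  case (insert m L)
  have split: "sign_mean (insert m L) (\<lambda>\<eta>. MAX t\<in>T. g t + (\<Sum>l\<in>insert m L. \<eta> l * w l t))
    = sign_mean L (\<lambda>\<eta>. ((MAX t\<in>T. (g t + (\<Sum>l\<in>L. \<eta> l * w l t)) + w m t)
        + (MAX t\<in>T. (g t + (\<Sum>l\<in>L. \<eta> l * w l t)) - w m t))) / 2" for w :: "'l \<Rightarrow> 't \<Rightarrow> real"
  proof -
    have plus: "(\<Sum>l\<in>insert m L. \<eta> l * w l t) = (\<Sum>l\<in>L. \<eta> l * w l t) + w m t"
      if "\<eta> \<in> signs L" for \<eta> t
      using insert signs_outside[OF that] by simp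
    have minus: "(\<Sum>l\<in>insert m L. (\<eta>(m := -1)) l * w l t) = (\<Sum>l\<in>L. \<eta> l * w l t) - w m t" for \<eta> t
    proof -
      have "(\<Sum>l\<in>L. (\<eta>(m := -1)) l * w l t) = (\<Sum>l\<in>L. \<eta> l * w l t)"
        using insert by (intro sum.cong) auto
      then show ?thesis using insert by simp
    qed
    show ?thesis
      unfolding sign_mean_insert[OF insert.hyps] sign_mean_add minus add_diff_eq add.assoc
      by (simp add: plus cong: sign_mean_cong del: sum.insert)
  qed
  have "sign_mean (insert m L) (\<lambda>\<eta>. MAX t\<in>T. g t + (\<Sum>l\<in>insert m L. \<eta> l * \<bar>v l t\<bar>))
      \<le> sign_mean L (\<lambda>\<eta>. ((MAX t\<in>T. (g t + (\<Sum>l\<in>L. \<eta> l * \<bar>v l t\<bar>)) + v m t)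
        + (MAX t\<in>T. (g t + (\<Sum>l\<in>L. \<eta> l * \<bar>v l t\<bar>)) - v m t))) / 2"
    unfolding split by (intro divide_right_mono sign_mean_mono MAX_add_abs_diff_abs T) simp
  also have "\<dots> = (sign_mean L (\<lambda>\<eta>. MAX t\<in>T. (g t + v m t) + (\<Sum>l\<in>L. \<eta> l * \<bar>v l t\<bar>))
        + sign_mean L (\<lambda>\<eta>. MAX t\<in>T. (g t - v m t) + (\<Sum>l\<in>L. \<eta> l * \<bar>v l t\<bar>))) / 2"
    by (simp add: sign_mean_add algebra_simps)
  also have "\<dots> \<le> (sign_mean L (\<lambda>\<eta>. MAX t\<in>T. (g t + v m t) + (\<Sum>l\<in>L. \<eta> l * v l t))
        + sign_mean L (\<lambda>\<eta>. MAX t\<in>T. (g t - v m t) + (\<Sum>l\<in>L. \<eta> l * v l t))) / 2"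
    using insert.IH by (intro divide_right_mono add_mono) auto
  also have "\<dots> = sign_mean (insert m L) (\<lambda>\<eta>. MAX t\<in>T. g t + (\<Sum>l\<in>insert m L. \<eta> l * v l t))"
    unfolding split by (simp add: sign_mean_add algebra_simps)
  finally show ?case .
qed

section \<open>Moments of polynomials in independent signs\<close>

definition walsh :: "'a set \<Rightarrow> ('a \<Rightarrow> real) \<Rightarrow> real" where
  "walsh S \<theta> = (\<Prod>v\<in>S. \<theta> v)"

text \<open>
  Flipping one sign with index in \<open>S\<close> reverses the sign of the product.
\<close>

lemma sign_mean_walsh:
  assumes "finite V" "S \<subseteq> V" "S \<noteq> {}"
  shows "sign_mean V (walsh S) = 0"
proof -
  obtain v where v: "v \<in> S" using assms(3) by blast
  have fin: "finite S" using assms finite_subset by blast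
  define s where "s = (\<lambda>_. 1 :: real)(v := -1)"
  have "s \<in> signs V" using v assms(2) by (auto simp: s_def signs_def)
  moreover have "walsh S (\<lambda>u. s u * \<theta> u) = - walsh S \<theta>" for \<theta>
    using v fin by (simp add: walsh_def prod.distrib s_def)
  ultimately have "sign_mean V (\<lambda>\<theta>. - walsh S \<theta>) = sign_mean V (walsh S)"
    using sign_mean_translate[of s V "walsh S"] by simp
  then show ?thesis using sign_mean_cmult[of V "-1" "walsh S"] by simp
qed

lemma walsh_mult:
  assumes "\<theta> \<in> signs V" "finite S" "finite S'"
  shows "walsh S \<theta> * walsh S' \<theta> = walsh (sym_diff S S') \<theta>"
proof -
  have sq: "\<theta> v * \<theta> v = 1" for v
    using signs_value[OF assms(1), of v] by auto
  have "walsh S \<theta> = walsh (S - S') \<theta> * walsh (S \<inter> S') \<theta>"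
    unfolding walsh_def using prod.Int_Diff[OF assms(2), of \<theta> S'] by (simp add: mult.commute)
  moreover have "walsh S' \<theta> = walsh (S' - S) \<theta> * walsh (S \<inter> S') \<theta>"
    unfolding walsh_def using prod.Int_Diff[OF assms(3), of \<theta> S] by (simp add: mult.commute Int_commute)
  moreover have "walsh (S \<inter> S') \<theta> * walsh (S \<inter> S') \<theta> = 1"
    unfolding walsh_def by (simp add: prod.distrib[symmetric] sq)
  moreover have "walsh (sym_diff S S') \<theta> = walsh (S - S') \<theta> * walsh (S' - S) \<theta>"
    unfolding walsh_def using assms by (intro prod.union_disjoint) auto
  ultimately show ?thesis by (simp add: algebra_simps)
qed

lemma walsh_parseval:
  assumes "finite V" "finite A" "inj_on S A" "\<And>i. i \<in> A \<Longrightarrow> S i \<subseteq> V"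
  shows "sign_mean V (\<lambda>\<theta>. (\<Sum>i\<in>A. a i * walsh (S i) \<theta>)\<^sup>2) = (\<Sum>i\<in>A. (a i)\<^sup>2)"
proof -
  have fin: "finite (S i)" if "i \<in> A" for i
    using that assms finite_subset by blast
  have orth: "sign_mean V (\<lambda>\<theta>. walsh (S i) \<theta> * walsh (S j) \<theta>) = (if i = j then 1 else 0)"
    if "i \<in> A" "j \<in> A" for i j
  proof -
    have "sign_mean V (\<lambda>\<theta>. walsh (S i) \<theta> * walsh (S j) \<theta>) = sign_mean V (walsh (sym_diff (S i) (S j)))"
      by (intro sign_mean_cong walsh_mult) (auto simp: fin that)
    also have "\<dots> = (if i = j then 1 else 0)"
    proof (cases "i = j")
      case True
      then show ?thesis using sign_mean_const[OF assms(1), of 1] by (simp add: walsh_def[abs_def])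
    next
      case False
      then have "S i \<noteq> S j" using that assms(3) by (auto dest: inj_onD)
      then have "sym_diff (S i) (S j) \<noteq> {}" by blast
      moreover have "sym_diff (S i) (S j) \<subseteq> V" using that assms(4) by blast
      ultimately show ?thesis using False by (simp add: sign_mean_walsh[OF assms(1)])
    qed
    finally show ?thesis .
  qed
  have "sign_mean V (\<lambda>\<theta>. (\<Sum>i\<in>A. a i * walsh (S i) \<theta>)\<^sup>2)
      = sign_mean V (\<lambda>\<theta>. \<Sum>i\<in>A. \<Sum>j\<in>A. a i * a j * (walsh (S i) \<theta> * walsh (S j) \<theta>))"
    by (simp add: power2_eq_square sum_product algebra_simps)
  also have "\<dots> = (\<Sum>i\<in>A. \<Sum>j\<in>A. a i * a j * (if i = j then 1 else 0))"
    by (simp add: sign_mean_sum sign_mean_cmult orth cong: sum.cong)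
  also have "\<dots> = (\<Sum>i\<in>A. (a i)\<^sup>2)"
    using assms(2) by (simp add: power2_eq_square if_distrib cong: if_cong)
  finally show ?thesis .
qed

lemma sign_mean_linear_square:
  assumes "finite V" "A \<subseteq> V"
  shows "sign_mean V (\<lambda>\<theta>. (\<Sum>i\<in>A. a i * \<theta> i)\<^sup>2) = (\<Sum>i\<in>A. (a i)\<^sup>2)"
  using walsh_parseval[of V A "\<lambda>i. {i}" a] assms finite_subset[of A V]
  by (auto simp: walsh_def inj_on_def)

lemma sign_mean_cauchy_schwarz:
  "(sign_mean V (\<lambda>\<theta>. F \<theta> * G \<theta>))\<^sup>2 \<le> sign_mean V (\<lambda>\<theta>. (F \<theta>)\<^sup>2) * sign_mean V (\<lambda>\<theta>. (G \<theta>)\<^sup>2)"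
proof -
  have "(\<Sum>\<theta>\<in>signs V. F \<theta> * G \<theta>)\<^sup>2 \<le> (\<Sum>\<theta>\<in>signs V. (F \<theta>)\<^sup>2) * (\<Sum>\<theta>\<in>signs V. (G \<theta>)\<^sup>2)"
    by (rule Cauchy_Schwarz_ineq_sum)
  then show ?thesis
    by (simp add: sign_mean_def power_divide power2_eq_square divide_right_mono)
qed

lemma sum_Pow_insert:
  assumes "finite V" "v \<notin> V"
  shows "(\<Sum>S\<in>Pow (insert v V). f S) = (\<Sum>S\<in>Pow V. f S) + (\<Sum>S\<in>Pow V. f (insert v S))"
proof -
  have "inj_on (insert v) (Pow V)"
    using assms(2) by (auto simp: inj_on_def)
  moreover have "Pow V \<inter> insert v ` Pow V = {}" using assms(2) by auto
  ultimately show ?thesis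
    using assms by (simp add: Pow_insert sum.union_disjoint sum.reindex)
qed

text \<open>
  Hypercontractivity of polynomials of degree at most \<open>m\<close>, by induction on the number of variables. Split
  off one variable and write the polynomial as \<open>g + \<theta> v * h\<close>. Averaging the fourth power over \<open>\<theta> v\<close> leaves
  \<open>g ^ 4 + 6 g\<^sup>2 h\<^sup>2 + h ^ 4\<close>. As \<open>h\<close> has degree at most \<open>m - 1\<close>, its fourth moment carries an extra factor
  \<open>1/9\<close>; by Cauchy-Schwarz the middle term gains \<open>1/3\<close>, which turns the 6 into the 2 of a complete square.
\<close>

lemma bonami_fourth_moment:
  assumes "finite V" "\<And>S. S \<subseteq> V \<Longrightarrow> a S \<noteq> 0 \<Longrightarrow> card S \<le> m"
  shows "sign_mean V (\<lambda>\<theta>. (\<Sum>S\<in>Pow V. a S * walsh S \<theta>) ^ 4) \<le> 9 ^ m * (\<Sum>S\<in>Pow V. (a S)\<^sup>2)\<^sup>2"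
  using assms
proof (induction V arbitrary: a m rule: finite_induct)
  case empty
  have "a {} ^ 4 \<le> 9 ^ m * a {} ^ 4"
    using mult_right_mono[of 1 "9 ^ m" "a {} ^ 4"] by simp
  then show ?case by (simp add: sign_mean_empty walsh_def)
next
  case (insert v V)
  define g where "g \<theta> = (\<Sum>S\<in>Pow V. a S * walsh S \<theta>)" for \<theta>
  define h where "h \<theta> = (\<Sum>S\<in>Pow V. a (insert v S) * walsh S \<theta>)" for \<theta>
  define x where "x = (\<Sum>S\<in>Pow V. (a S)\<^sup>2)"
  define y where "y = (\<Sum>S\<in>Pow V. (a (insert v S))\<^sup>2)"
  have nonneg: "x \<ge> 0" "y \<ge> 0" by (auto simp: x_def y_def intro: sum_nonneg)
  have wins: "walsh (insert v S) \<theta> = \<theta> v * walsh S \<theta>" if "S \<subseteq> V" for S \<theta>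
    using that insert.hyps finite_subset[of S V] by (subst walsh_def, subst prod.insert) (auto simp: walsh_def)
  have wupd: "walsh S (\<theta>(v := c)) = walsh S \<theta>" if "S \<subseteq> V" for S \<theta> c
    unfolding walsh_def using that insert.hyps by (intro prod.cong) auto
  have f: "(\<Sum>S\<in>Pow (insert v V). a S * walsh S \<theta>) = g \<theta> + \<theta> v * h \<theta>" for \<theta>
    by (simp add: sum_Pow_insert insert.hyps g_def h_def sum_distrib_left wins mult.left_commute)
  have upd: "g (\<theta>(v := c)) = g \<theta>" "h (\<theta>(v := c)) = h \<theta>" for \<theta> c
    by (simp_all add: g_def h_def wupd)
  have g4: "sign_mean V (\<lambda>\<theta>. g \<theta> ^ 4) \<le> 9 ^ m * x\<^sup>2"
    unfolding g_def x_def by (rule insert.IH) (use insert.prems in auto)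
  have h4: "9 * sign_mean V (\<lambda>\<theta>. h \<theta> ^ 4) \<le> 9 ^ m * y\<^sup>2"
  proof (cases m)
    case 0
    have "a (insert v S) = 0" if "S \<subseteq> V" for S
    proof (rule ccontr)
      assume "a (insert v S) \<noteq> 0"
      then have "card (insert v S) = 0" using insert.prems[of "insert v S"] that 0 by auto
      then show False using that insert.hyps finite_subset[of S V] by simp
    qed
    then have "h \<theta> = 0" for \<theta> by (simp add: h_def)
    then show ?thesis by (simp add: sign_mean_const insert.hyps)
  next
    case (Suc k)
    have "sign_mean V (\<lambda>\<theta>. h \<theta> ^ 4) \<le> 9 ^ k * y\<^sup>2"
      unfolding h_def y_def
    proof (rule insert.IH)
      fix S assume S: "S \<subseteq> V" "a (insert v S) \<noteq> 0"
      then have "card (insert v S) \<le> m" using insert.prems[of "insert v S"] by auto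
      then show "card S \<le> k"
        using S Suc insert.hyps finite_subset[of S V] by (subst (asm) card_insert_disjoint) auto
    qed
    then show ?thesis using Suc by simp
  qed
  define z where "z = sign_mean V (\<lambda>\<theta>. (g \<theta>)\<^sup>2 * (h \<theta>)\<^sup>2)"
  have gh: "3 * z \<le> 9 ^ m * (x * y)"
  proof (rule power2_le_imp_le)
    have "z\<^sup>2 \<le> sign_mean V (\<lambda>\<theta>. g \<theta> ^ 4) * sign_mean V (\<lambda>\<theta>. h \<theta> ^ 4)"
      unfolding z_def using sign_mean_cauchy_schwarz[of V "\<lambda>\<theta>. (g \<theta>)\<^sup>2" "\<lambda>\<theta>. (h \<theta>)\<^sup>2"]
      by (simp add: power_mult[symmetric])
    then have "(3 * z)\<^sup>2 \<le> sign_mean V (\<lambda>\<theta>. g \<theta> ^ 4) * (9 * sign_mean V (\<lambda>\<theta>. h \<theta> ^ 4))"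
      by (simp add: power_mult_distrib)
    also have "\<dots> \<le> (9 ^ m * x\<^sup>2) * (9 ^ m * y\<^sup>2)"
      using sign_mean_mono[of V "\<lambda>_. 0" "\<lambda>\<theta>. h \<theta> ^ 4"]
      by (intro mult_mono[OF g4 h4]) (simp_all add: sign_mean_const insert.hyps)
    finally show "(3 * z)\<^sup>2 \<le> (9 ^ m * (x * y))\<^sup>2"
      by (simp add: power_mult_distrib power2_eq_square mult_ac)
  qed (use nonneg in simp)
  have "sign_mean (insert v V) (\<lambda>\<theta>. (\<Sum>S\<in>Pow (insert v V). a S * walsh S \<theta>) ^ 4)
      = (sign_mean V (\<lambda>\<theta>. (g \<theta> + h \<theta>) ^ 4) + sign_mean V (\<lambda>\<theta>. (g \<theta> - h \<theta>) ^ 4)) / 2"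
  proof -
    have "sign_mean V (\<lambda>\<theta>. (g \<theta> + \<theta> v * h \<theta>) ^ 4) = sign_mean V (\<lambda>\<theta>. (g \<theta> + h \<theta>) ^ 4)"
      using insert.hyps(2) by (intro sign_mean_cong) (simp add: signs_outside[of _ V v])
    then show ?thesis
      by (simp add: f sign_mean_insert insert.hyps upd)
  qed
  also have "\<dots> = sign_mean V (\<lambda>\<theta>. g \<theta> ^ 4) + 6 * z + sign_mean V (\<lambda>\<theta>. h \<theta> ^ 4)"
  proof -
    have "(g \<theta> + h \<theta>) ^ 4 + (g \<theta> - h \<theta>) ^ 4 = 2 * (g \<theta> ^ 4 + 6 * ((g \<theta>)\<^sup>2 * (h \<theta>)\<^sup>2) + h \<theta> ^ 4)" for \<theta>
      by algebra
    then have "sign_mean V (\<lambda>\<theta>. (g \<theta> + h \<theta>) ^ 4) + sign_mean V (\<lambda>\<theta>. (g \<theta> - h \<theta>) ^ 4)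
        = 2 * (sign_mean V (\<lambda>\<theta>. g \<theta> ^ 4) + 6 * z + sign_mean V (\<lambda>\<theta>. h \<theta> ^ 4))"
      unfolding sign_mean_add[symmetric] by (simp only: sign_mean_cmult sign_mean_add z_def)
    then show ?thesis by simp
  qed
  also have "\<dots> \<le> 9 ^ m * x\<^sup>2 + 2 * (9 ^ m * (x * y)) + 9 ^ m * y\<^sup>2"
    using g4 h4 gh sign_mean_mono[of V "\<lambda>_. 0" "\<lambda>\<theta>. h \<theta> ^ 4"]
    by (simp add: sign_mean_const insert.hyps)
  also have "\<dots> = 9 ^ m * (x + y)\<^sup>2"
    by (simp add: power2_sum algebra_simps)
  also have "x + y = (\<Sum>S\<in>Pow (insert v V). (a S)\<^sup>2)"
    by (simp add: sum_Pow_insert insert.hyps x_def y_def)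
  finally show ?case .
qed

text \<open>
  A random variable whose fourth moment is controlled by its second moment cannot be small in the mean:
  this follows by averaging the pointwise inequality \<open>y\<^sup>2 - y ^ 4 \<le> y\<close>, \<open>y \<ge> 0\<close>, at a suitable scale.
\<close>

lemma walsh_khintchine:
  assumes "finite V" "finite A" "inj_on S A" "\<And>i. i \<in> A \<Longrightarrow> S i \<subseteq> V" "\<And>i. i \<in> A \<Longrightarrow> card (S i) \<le> m"
  shows "sqrt (\<Sum>i\<in>A. (a i)\<^sup>2) / (4 * 3 ^ m) \<le> sign_mean V (\<lambda>\<theta>. \<bar>\<Sum>i\<in>A. a i * walsh (S i) \<theta>\<bar>)"
proof -
  define f where "f \<theta> = (\<Sum>i\<in>A. a i * walsh (S i) \<theta>)" for \<theta>
  define \<sigma> where "\<sigma> = sqrt (\<Sum>i\<in>A. (a i)\<^sup>2)"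
  \<comment> \<open>The coefficients as a function of the monomial, extended by zero to all subsets of the variables.\<close>
  define b where "b R = (if R \<in> S ` A then a (the_inv_into A S R) else 0)" for R
  have b: "b (S i) = a i" if "i \<in> A" for i
    using that assms(3) by (simp add: b_def the_inv_into_f_f)
  have sum_b: "(\<Sum>R\<in>Pow V. F (b R) R) = (\<Sum>i\<in>A. F (a i) (S i))" if "\<And>R. F 0 R = 0" for F :: "real \<Rightarrow> 'a set \<Rightarrow> real"
  proof -
    have "(\<Sum>R\<in>Pow V. F (b R) R) = (\<Sum>R\<in>S ` A. F (b R) R)"
      using assms by (intro sum.mono_neutral_right) (auto simp: b_def that)
    also have "\<dots> = (\<Sum>i\<in>A. F (a i) (S i))"
      using assms(3) by (simp add: sum.reindex b)
    finally show ?thesis .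
  qed
  have sq: "\<sigma>\<^sup>2 = (\<Sum>i\<in>A. (a i)\<^sup>2)"
    unfolding \<sigma>_def by (simp add: sum_nonneg)
  have f2: "sign_mean V (\<lambda>\<theta>. (f \<theta>)\<^sup>2) = \<sigma>\<^sup>2"
    unfolding f_def sq by (rule walsh_parseval) (use assms in auto)
  have f4: "sign_mean V (\<lambda>\<theta>. f \<theta> ^ 4) \<le> 9 ^ m * \<sigma> ^ 4"
  proof -
    have "card R \<le> m" if "b R \<noteq> 0" for R
      using that assms(5) by (auto simp: b_def split: if_splits)
    then have "sign_mean V (\<lambda>\<theta>. (\<Sum>R\<in>Pow V. b R * walsh R \<theta>) ^ 4) \<le> 9 ^ m * (\<Sum>R\<in>Pow V. (b R)\<^sup>2)\<^sup>2"
      by (intro bonami_fourth_moment assms(1)) auto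
    then show ?thesis
      using sum_b[of "\<lambda>c R. c * walsh R _"] sum_b[of "\<lambda>c R. c\<^sup>2"]
      by (simp add: f_def sq[symmetric] power_mult[symmetric])
  qed
  show ?thesis
  proof (cases "\<sigma> = 0")
    case True
    have "0 \<le> sign_mean V (\<lambda>\<theta>. \<bar>f \<theta>\<bar>)"
      using sign_mean_mono[of V "\<lambda>_. 0" "\<lambda>\<theta>. \<bar>f \<theta>\<bar>"] by (simp add: sign_mean_const assms(1))
    then show ?thesis unfolding \<sigma>_def[symmetric] f_def[symmetric] True by simp
  next
    case False
    then have pos: "\<sigma> > 0" using sq sum_nonneg[of A "\<lambda>i. (a i)\<^sup>2"] by (simp add: \<sigma>_def)
    \<comment> \<open>At this scale the fourth moment term is at most a quarter of the second moment term.\<close>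
    define u where "u = 2 * 3 ^ m * \<sigma>"
    have u: "u > 0" using pos by (simp add: u_def)
    have pw: "(1 / u) * (f \<theta>)\<^sup>2 - (1 / u ^ 3) * f \<theta> ^ 4 \<le> \<bar>f \<theta>\<bar>" for \<theta>
    proof -
      define y where "y = \<bar>f \<theta>\<bar> / u"
      have y: "y \<ge> 0" using u by (simp add: y_def)
      have "y \<le> 1 + y ^ 3"
      proof (cases "y \<le> 1")
        case True then show ?thesis using y by (simp add: add_increasing2)
      next
        case False
        then have "y ^ 1 \<le> y ^ 3" by (intro power_increasing) auto
        then show ?thesis by simp
      qed
      then have "y * y \<le> y * (1 + y ^ 3)" using y by (rule mult_left_mono)
      then have "u * (y\<^sup>2 - y ^ 4) \<le> u * y"
        using u by (intro mult_left_mono) (auto simp: algebra_simps power2_eq_square eval_nat_numeral)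
      moreover have "u * y = \<bar>f \<theta>\<bar>" using u by (simp add: y_def)
      moreover have "u * (y\<^sup>2 - y ^ 4) = (1 / u) * (f \<theta>)\<^sup>2 - (1 / u ^ 3) * f \<theta> ^ 4"
        using u by (simp add: y_def power_divide power_even_abs field_simps eval_nat_numeral)
      ultimately show ?thesis by simp
    qed
    have "\<sigma> / (4 * 3 ^ m) \<le> (1 / u) * \<sigma>\<^sup>2 - (1 / u ^ 3) * (9 ^ m * \<sigma> ^ 4)"
    proof -
      have "(9 :: real) ^ m = 3 ^ m * 3 ^ m" by (simp add: power_mult_distrib[symmetric])
      then have "(1 / u) * \<sigma>\<^sup>2 - (1 / u ^ 3) * (9 ^ m * \<sigma> ^ 4) = 3 / 8 * (\<sigma> / 3 ^ m)"
        using pos by (simp add: u_def field_simps eval_nat_numeral)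
      moreover have "\<sigma> / 3 ^ m \<ge> 0" using pos by simp
      ultimately show ?thesis by simp
    qed
    also have "\<dots> \<le> (1 / u) * sign_mean V (\<lambda>\<theta>. (f \<theta>)\<^sup>2) - (1 / u ^ 3) * sign_mean V (\<lambda>\<theta>. f \<theta> ^ 4)"
      using f4 u by (simp add: f2 divide_right_mono)
    also have "\<dots> \<le> sign_mean V (\<lambda>\<theta>. \<bar>f \<theta>\<bar>)"
      unfolding sign_mean_cmult[symmetric] sign_mean_diff[symmetric] by (rule sign_mean_mono) (rule pw)
    finally show ?thesis unfolding \<sigma>_def[symmetric] f_def[symmetric] .
  qed
qed

section \<open>The upper bound for random sums\<close>

text \<open>
  The first term on the right bounds the mean of \<open>\<Sum> l. \<bar>X l\<bar>\<close> at any point \<open>t\<close>, the second the expected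
  maximal deviation from this mean. For the latter the mean is replaced by an independent copy and
  symmetrised with signs \<open>\<eta> l\<close>; the two copies contribute equally, whence the factor 2. The contraction
  principle replaces \<open>\<eta> l * \<bar>X l\<bar>\<close> by \<open>\<eta> l * X l\<close>, and in \<open>X l\<close> the sign \<open>\<eta> l\<close> merges with \<open>\<theta>\<close>.
\<close>

lemma sign_mean_MAX_block_abs:
  fixes X :: "'l \<Rightarrow> ('j \<Rightarrow> real) \<Rightarrow> 't \<Rightarrow> real" and a :: "'j \<Rightarrow> real" and x :: "'j \<Rightarrow> 't \<Rightarrow> real"
  assumes fin: "finite J" "finite L" and p: "p ` J \<subseteq> L" and T: "finite T" "T \<noteq> {}"
    and x: "\<And>j t. t \<in> T \<Longrightarrow> \<bar>x j t\<bar> = 1"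
  defines "X \<equiv> \<lambda>l \<theta> t. \<Sum>j\<in>{j \<in> J. p j = l}. a j * \<theta> j * x j t"
  shows "sign_mean J (\<lambda>\<theta>. MAX t\<in>T. \<Sum>l\<in>L. \<bar>X l \<theta> t\<bar>)
     \<le> (\<Sum>l\<in>L. sqrt (\<Sum>j\<in>{j \<in> J. p j = l}. (a j)\<^sup>2))
       + 2 * sign_mean J (\<lambda>\<theta>. MAX t\<in>T. \<Sum>j\<in>J. a j * \<theta> j * x j t)"
proof -
  define M where "M = (\<Sum>l\<in>L. sqrt (\<Sum>j\<in>{j \<in> J. p j = l}. (a j)\<^sup>2))"
  define D where "D \<theta> \<theta>' = (MAX t\<in>T. \<Sum>l\<in>L. \<bar>X l \<theta> t\<bar> - \<bar>X l \<theta>' t\<bar>)" for \<theta> \<theta>'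
  define E where "E \<theta> = sign_mean L (\<lambda>\<eta>. MAX t\<in>T. \<Sum>l\<in>L. \<eta> l * \<bar>X l \<theta> t\<bar>)" for \<theta>
  have mean_X: "sign_mean J (\<lambda>\<theta>. \<Sum>l\<in>L. \<bar>X l \<theta> t\<bar>) \<le> M" if t: "t \<in> T" for t
    unfolding sign_mean_sum M_def
  proof (rule sum_mono)
    fix l assume "l \<in> L"
    have "sign_mean J (\<lambda>\<theta>. \<bar>X l \<theta> t\<bar>) = sign_mean J (\<lambda>\<theta>. sqrt ((X l \<theta> t)\<^sup>2))"
      by simp
    also have "\<dots> \<le> sqrt (sign_mean J (\<lambda>\<theta>. (X l \<theta> t)\<^sup>2))"
      by (rule sign_mean_sqrt_le) (auto simp: fin)
    also have "sign_mean J (\<lambda>\<theta>. (X l \<theta> t)\<^sup>2) = (\<Sum>j\<in>{j \<in> J. p j = l}. (a j * x j t)\<^sup>2)"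
      using sign_mean_linear_square[of J "{j \<in> J. p j = l}" "\<lambda>j. a j * x j t"] fin
      by (simp add: X_def mult_ac)
    also have "\<dots> = (\<Sum>j\<in>{j \<in> J. p j = l}. (a j)\<^sup>2)"
    proof (rule sum.cong[OF refl])
      fix j
      have "(x j t)\<^sup>2 = 1" using x[OF t, of j] by (metis abs_square_eq_1)
      then show "(a j * x j t)\<^sup>2 = (a j)\<^sup>2" by (simp add: power_mult_distrib)
    qed
    finally show "sign_mean J (\<lambda>\<theta>. \<bar>X l \<theta> t\<bar>) \<le> sqrt (\<Sum>j\<in>{j \<in> J. p j = l}. (a j)\<^sup>2)" .
  qed
  have center: "(MAX t\<in>T. \<Sum>l\<in>L. \<bar>X l \<theta> t\<bar>) \<le> M + sign_mean J (D \<theta>)" for \<theta>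
  proof (rule MAX_le[OF T])
    fix t assume t: "t \<in> T"
    have "(\<Sum>l\<in>L. \<bar>X l \<theta> t\<bar>) = sign_mean J (\<lambda>\<theta>'. \<Sum>l\<in>L. \<bar>X l \<theta>' t\<bar>)
        + sign_mean J (\<lambda>\<theta>'. \<Sum>l\<in>L. \<bar>X l \<theta> t\<bar> - \<bar>X l \<theta>' t\<bar>)"
      by (simp add: sign_mean_add[symmetric] sum.distrib[symmetric] sign_mean_const fin)
    also have "sign_mean J (\<lambda>\<theta>'. \<Sum>l\<in>L. \<bar>X l \<theta> t\<bar> - \<bar>X l \<theta>' t\<bar>) \<le> sign_mean J (D \<theta>)"
      unfolding D_def by (intro sign_mean_mono MAX_ge T t)
    finally show "(\<Sum>l\<in>L. \<bar>X l \<theta> t\<bar>) \<le> M + sign_mean J (D \<theta>)"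
      using mean_X[OF t] by simp
  qed
  \<comment> \<open>Exchanging the copies on the blocks with negative \<open>\<eta> l\<close> changes the sign of just these differences.\<close>
  have symm: "sign_mean J (\<lambda>\<theta>. sign_mean J (D \<theta>))
      = sign_mean J (\<lambda>\<theta>. sign_mean J (\<lambda>\<theta>'. MAX t\<in>T. \<Sum>l\<in>L. \<eta> l * (\<bar>X l \<theta> t\<bar> - \<bar>X l \<theta>' t\<bar>)))"
    if \<eta>: "\<eta> \<in> signs L" for \<eta>
  proof -
    define mix where "mix \<theta> \<theta>' j = (if \<eta> (p j) = 1 then \<theta> j else \<theta>' j)" for \<theta> \<theta>' :: "'j \<Rightarrow> real" and j
    have X_mix: "X l (mix \<theta> \<theta>') t = (if \<eta> l = 1 then X l \<theta> t else X l \<theta>' t)" for l \<theta> \<theta>' t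
      by (auto simp: X_def mix_def intro!: sum.cong)
    have "D (mix \<theta> \<theta>') (mix \<theta>' \<theta>) = (MAX t\<in>T. \<Sum>l\<in>L. \<eta> l * (\<bar>X l \<theta> t\<bar> - \<bar>X l \<theta>' t\<bar>))" for \<theta> \<theta>'
    proof -
      have "\<bar>X l (mix \<theta> \<theta>') t\<bar> - \<bar>X l (mix \<theta>' \<theta>) t\<bar> = \<eta> l * (\<bar>X l \<theta> t\<bar> - \<bar>X l \<theta>' t\<bar>)" for l t
        unfolding X_mix using signs_value[OF \<eta>, of l] by auto
      then show ?thesis unfolding D_def by simp
    qed
    then show ?thesis
      using sign_mean_exchange[of J D "\<lambda>j. \<eta> (p j) = 1"] by (simp add: mix_def[abs_def])
  qed
  have "sign_mean J (\<lambda>\<theta>. sign_mean J (D \<theta>))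
      = sign_mean L (\<lambda>\<eta>. sign_mean J (\<lambda>\<theta>. sign_mean J (D \<theta>)))"
    by (simp add: sign_mean_const fin)
  also have "\<dots> = sign_mean L (\<lambda>\<eta>. sign_mean J (\<lambda>\<theta>. sign_mean J (\<lambda>\<theta>'.
      MAX t\<in>T. \<Sum>l\<in>L. \<eta> l * (\<bar>X l \<theta> t\<bar> - \<bar>X l \<theta>' t\<bar>))))"
    by (rule sign_mean_cong) (rule symm)
  also have "\<dots> \<le> sign_mean L (\<lambda>\<eta>. sign_mean J (\<lambda>\<theta>. sign_mean J (\<lambda>\<theta>'.
      (MAX t\<in>T. \<Sum>l\<in>L. \<eta> l * \<bar>X l \<theta> t\<bar>) + (MAX t\<in>T. \<Sum>l\<in>L. - \<eta> l * \<bar>X l \<theta>' t\<bar>))))"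
  proof (intro sign_mean_mono MAX_le T)
    fix \<eta> \<theta> \<theta>' t assume t: "t \<in> T"
    have "(\<Sum>l\<in>L. \<eta> l * (\<bar>X l \<theta> t\<bar> - \<bar>X l \<theta>' t\<bar>))
        = (\<Sum>l\<in>L. \<eta> l * \<bar>X l \<theta> t\<bar>) + (\<Sum>l\<in>L. - \<eta> l * \<bar>X l \<theta>' t\<bar>)"
      by (simp add: sum.distrib[symmetric] algebra_simps)
    also have "\<dots> \<le> (MAX t\<in>T. \<Sum>l\<in>L. \<eta> l * \<bar>X l \<theta> t\<bar>) + (MAX t\<in>T. \<Sum>l\<in>L. - \<eta> l * \<bar>X l \<theta>' t\<bar>)"
      by (intro add_mono MAX_ge T t)
    finally show "(\<Sum>l\<in>L. \<eta> l * (\<bar>X l \<theta> t\<bar> - \<bar>X l \<theta>' t\<bar>)) \<le> \<dots>" .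
  qed
  also have "\<dots> = sign_mean L (\<lambda>\<eta>. sign_mean J (\<lambda>\<theta>. MAX t\<in>T. \<Sum>l\<in>L. \<eta> l * \<bar>X l \<theta> t\<bar>))
      + sign_mean L (\<lambda>\<eta>. sign_mean J (\<lambda>\<theta>. MAX t\<in>T. \<Sum>l\<in>L. - \<eta> l * \<bar>X l \<theta> t\<bar>))"
    by (simp add: sign_mean_add sign_mean_const fin)
  also have "\<dots> = 2 * sign_mean J E"
  proof -
    have "sign_mean L (\<lambda>\<eta>. G (\<lambda>l. - \<eta> l)) = sign_mean L G"
      if "\<And>\<eta> \<eta>'. (\<And>l. l \<in> L \<Longrightarrow> \<eta> l = \<eta>' l) \<Longrightarrow> G \<eta> = G \<eta>'" for G
    proof -
      define s where "s l = (if l \<in> L then -1 else 1 :: real)" for l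
      have "s \<in> signs L" by (auto simp: s_def signs_def)
      moreover have "G (\<lambda>l. - \<eta> l) = G (\<lambda>l. s l * \<eta> l)" for \<eta>
        by (rule that) (simp add: s_def)
      ultimately show ?thesis using sign_mean_translate[of s L G] by simp
    qed
    from this[of "\<lambda>\<eta>. MAX t\<in>T. \<Sum>l\<in>L. \<eta> l * \<bar>X l _ t\<bar>"]
    have "sign_mean L (\<lambda>\<eta>. MAX t\<in>T. \<Sum>l\<in>L. - \<eta> l * \<bar>X l \<theta> t\<bar>) = E \<theta>" for \<theta>
      unfolding E_def by simp
    then show ?thesis
      by (subst (1 2) sign_mean_swap) (simp add: E_def[symmetric])
  qed
  finally have DE: "sign_mean J (\<lambda>\<theta>. sign_mean J (D \<theta>)) \<le> 2 * sign_mean J E" .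
  have "sign_mean J E \<le> sign_mean J (\<lambda>\<theta>. sign_mean L (\<lambda>\<eta>. MAX t\<in>T. \<Sum>l\<in>L. \<eta> l * X l \<theta> t))"
  proof (rule sign_mean_mono)
    fix \<theta>
    show "E \<theta> \<le> sign_mean L (\<lambda>\<eta>. MAX t\<in>T. \<Sum>l\<in>L. \<eta> l * X l \<theta> t)"
      unfolding E_def using sign_mean_contraction[OF fin(2) T, of "\<lambda>_. 0" "\<lambda>l. X l \<theta>"] by simp
  qed
  also have "\<dots> = sign_mean J (\<lambda>\<theta>. sign_mean L (\<lambda>\<eta>. MAX t\<in>T. \<Sum>j\<in>J. a j * (\<eta> (p j) * \<theta> j) * x j t))"
  proof -
    have "(\<Sum>l\<in>L. \<eta> l * X l \<theta> t) = (\<Sum>j\<in>J. a j * (\<eta> (p j) * \<theta> j) * x j t)" for \<eta> \<theta> t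
    proof -
      have "(\<Sum>l\<in>L. \<eta> l * X l \<theta> t) = (\<Sum>l\<in>L. \<Sum>j\<in>{j \<in> J. p j = l}. a j * (\<eta> (p j) * \<theta> j) * x j t)"
        by (simp add: X_def sum_distrib_left mult_ac)
      also have "\<dots> = (\<Sum>j\<in>J. a j * (\<eta> (p j) * \<theta> j) * x j t)"
        using fin p by (rule sum.group)
      finally show ?thesis .
    qed
    then show ?thesis by simp
  qed
  also have "\<dots> = sign_mean J (\<lambda>\<theta>. MAX t\<in>T. \<Sum>j\<in>J. a j * \<theta> j * x j t)"
    by (rule sign_mean_randomize[OF fin(2) p, of "\<lambda>\<theta>. MAX t\<in>T. \<Sum>j\<in>J. a j * \<theta> j * x j t"]) simp
  finally have EF: "sign_mean J E \<le> \<dots>" .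
  have "sign_mean J (\<lambda>\<theta>. MAX t\<in>T. \<Sum>l\<in>L. \<bar>X l \<theta> t\<bar>) \<le> sign_mean J (\<lambda>\<theta>. M + sign_mean J (D \<theta>))"
    by (rule sign_mean_mono) (rule center)
  also have "\<dots> = M + sign_mean J (\<lambda>\<theta>. sign_mean J (D \<theta>))"
    by (simp add: sign_mean_add sign_mean_const fin)
  finally show ?thesis
    using DE EF unfolding M_def by linarith
qed

lemma finite_multi_indices: "finite (multi_indices d n)"
  by (simp add: multi_indices_def finite_PiE)

lemma finite_multi_indices_section: "finite (multi_indices_section d n k l)"
  by (simp add: multi_indices_section_def finite_multi_indices)

text \<open>
  The points \<open>t\<close> only serve as indices of sign patterns, and the same family of patterns is used for all
  \<open>d\<close>. Without an absolute value the sum for \<open>d = 0\<close> is a single random sign times a constant and has mean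
  zero, so the induction can start there.
\<close>

lemma sign_mean_MAX_multi_sum:
  fixes r :: "nat \<Rightarrow> nat \<Rightarrow> 't \<Rightarrow> real"
  assumes T: "finite T" "T \<noteq> {}" and r: "\<And>k l t. t \<in> T \<Longrightarrow> \<bar>r k l t\<bar> = 1"
  shows "sign_mean (multi_indices d n)
           (\<lambda>\<theta>. MAX t\<in>T. \<Sum>j\<in>multi_indices d n. a j * \<theta> j * (\<Prod>k=1..d. r k (j k) t))
       \<le> (\<Sum>k=1..d. 2 ^ (d - k) * (\<Sum>l=1..n. sqrt (\<Sum>j\<in>multi_indices_section d n k l. (a j)\<^sup>2)))"
proof (induction d arbitrary: a)
  case 0
  have "sign_mean {u} (\<lambda>\<theta>. c * \<theta> u) = 0" for c and u :: "nat \<Rightarrow> nat"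
    using sign_mean_insert[of "{}" u "\<lambda>\<theta>. c * \<theta> u"] by (simp add: sign_mean_empty)
  moreover have "multi_indices 0 n = {\<lambda>_. undefined}" by (simp add: multi_indices_def)
  ultimately show ?case using T by simp
next
  case (Suc d)
  define I where "I = multi_indices d n"
  define J where "J = multi_indices (Suc d) n"
  define x where "x j t = (\<Prod>k=1..d. r k (j k) t)" for j t
  \<comment> \<open>\<open>\<rho>\<close> forgets the last index; \<open>b \<theta>\<close> are the random coefficients of the remaining sum.\<close>
  define \<rho> where "\<rho> j = restrict j {1..d}" for j :: "nat \<Rightarrow> nat"
  define b where "b \<theta> i = (\<Sum>j\<in>{j \<in> J. \<rho> j = i}. a j * \<theta> j)" for \<theta> i
  have fin: "finite I" "finite J" by (simp_all add: I_def J_def finite_multi_indices)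
  have last: "(\<lambda>j. j (Suc d)) ` J \<subseteq> {1..n}"
    by (auto simp: J_def multi_indices_def)
  have \<rho>: "\<rho> ` J \<subseteq> I"
    by (auto simp: J_def I_def \<rho>_def multi_indices_def)
  have x1: "\<bar>x j t\<bar> = 1" if "t \<in> T" for j t
    using r[OF that] by (simp add: x_def abs_prod)
  have x\<rho>: "x (\<rho> j) t = x j t" for j t
    unfolding x_def \<rho>_def by (intro prod.cong) auto
  have sec: "{j \<in> J. j (Suc d) = l} = multi_indices_section (Suc d) n (Suc d) l" for l
    by (simp add: J_def multi_indices_section_def)
  have "(MAX t\<in>T. \<Sum>j\<in>J. a j * \<theta> j * (\<Prod>k=1..Suc d. r k (j k) t))
      \<le> (MAX t\<in>T. \<Sum>l=1..n. \<bar>\<Sum>j\<in>{j \<in> J. j (Suc d) = l}. a j * \<theta> j * x j t\<bar>)" for \<theta>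
  proof (rule MAX_le[OF T])
    fix t assume t: "t \<in> T"
    have "(\<Sum>j\<in>J. a j * \<theta> j * (\<Prod>k=1..Suc d. r k (j k) t))
        = (\<Sum>l=1..n. \<Sum>j\<in>{j \<in> J. j (Suc d) = l}. a j * \<theta> j * (\<Prod>k=1..Suc d. r k (j k) t))"
      using fin last by (intro sum.group[symmetric]) auto
    also have "\<dots> = (\<Sum>l=1..n. r (Suc d) l t * (\<Sum>j\<in>{j \<in> J. j (Suc d) = l}. a j * \<theta> j * x j t))"
      unfolding sum_distrib_left by (intro sum.cong) (auto simp: x_def)
    also have "\<dots> \<le> (\<Sum>l=1..n. \<bar>\<Sum>j\<in>{j \<in> J. j (Suc d) = l}. a j * \<theta> j * x j t\<bar>)"
    proof (rule sum_mono)
      fix l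
      show "r (Suc d) l t * S \<le> \<bar>S\<bar>" for S
        using r[OF t, of "Suc d" l] abs_ge_self[of "r (Suc d) l t * S"] by (simp add: abs_mult)
    qed
    also have "\<dots> \<le> (MAX t\<in>T. \<Sum>l=1..n. \<bar>\<Sum>j\<in>{j \<in> J. j (Suc d) = l}. a j * \<theta> j * x j t\<bar>)"
      by (rule MAX_ge[OF T(1) t])
    finally show "(\<Sum>j\<in>J. a j * \<theta> j * (\<Prod>k=1..Suc d. r k (j k) t)) \<le> \<dots>" .
  qed
  then have "sign_mean J (\<lambda>\<theta>. MAX t\<in>T. \<Sum>j\<in>J. a j * \<theta> j * (\<Prod>k=1..Suc d. r k (j k) t))
      \<le> sign_mean J (\<lambda>\<theta>. MAX t\<in>T. \<Sum>l=1..n. \<bar>\<Sum>j\<in>{j \<in> J. j (Suc d) = l}. a j * \<theta> j * x j t\<bar>)"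
    by (rule sign_mean_mono)
  also have "\<dots> \<le> (\<Sum>l=1..n. sqrt (\<Sum>j\<in>{j \<in> J. j (Suc d) = l}. (a j)\<^sup>2))
      + 2 * sign_mean J (\<lambda>\<theta>. MAX t\<in>T. \<Sum>j\<in>J. a j * \<theta> j * x j t)"
    by (rule sign_mean_MAX_block_abs) (use fin last T x1 in auto)
  also have "sign_mean J (\<lambda>\<theta>. MAX t\<in>T. \<Sum>j\<in>J. a j * \<theta> j * x j t)
      = sign_mean J (\<lambda>\<theta>. sign_mean I (\<lambda>\<eta>. MAX t\<in>T. \<Sum>j\<in>J. a j * (\<eta> (\<rho> j) * \<theta> j) * x j t))"
    by (rule sign_mean_randomize[OF fin(1) \<rho>, symmetric, of "\<lambda>\<theta>. MAX t\<in>T. \<Sum>j\<in>J. a j * \<theta> j * x j t"]) simp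
  also have "\<dots> = sign_mean J (\<lambda>\<theta>. sign_mean I (\<lambda>\<eta>. MAX t\<in>T. \<Sum>i\<in>I. b \<theta> i * \<eta> i * x i t))"
  proof -
    have "(\<Sum>j\<in>J. a j * (\<eta> (\<rho> j) * \<theta> j) * x j t) = (\<Sum>i\<in>I. b \<theta> i * \<eta> i * x i t)" for \<theta> \<eta> t
    proof -
      have "(\<Sum>j\<in>J. a j * (\<eta> (\<rho> j) * \<theta> j) * x j t)
          = (\<Sum>i\<in>I. \<Sum>j\<in>{j \<in> J. \<rho> j = i}. a j * (\<eta> (\<rho> j) * \<theta> j) * x (\<rho> j) t)"
        unfolding x\<rho> by (rule sum.group[OF fin(2,1) \<rho>, symmetric])
      also have "\<dots> = (\<Sum>i\<in>I. b \<theta> i * \<eta> i * x i t)"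
        by (simp add: b_def sum_distrib_right sum_distrib_left mult_ac)
      finally show ?thesis .
    qed
    then show ?thesis by simp
  qed
  also have "\<dots> \<le> sign_mean J (\<lambda>\<theta>. \<Sum>k=1..d. 2 ^ (d - k) * (\<Sum>l=1..n. sqrt (\<Sum>i\<in>multi_indices_section d n k l. (b \<theta> i)\<^sup>2)))"
    unfolding I_def x_def by (rule sign_mean_mono) (rule Suc.IH)
  also have "\<dots> = (\<Sum>k=1..d. 2 ^ (d - k) * (\<Sum>l=1..n.
      sign_mean J (\<lambda>\<theta>. sqrt (\<Sum>i\<in>multi_indices_section d n k l. (b \<theta> i)\<^sup>2))))"
    by (simp add: sign_mean_sum sign_mean_cmult)
  also have "\<dots> \<le> (\<Sum>k=1..d. 2 ^ (d - k) * (\<Sum>l=1..n. sqrt (\<Sum>j\<in>multi_indices_section (Suc d) n k l. (a j)\<^sup>2)))"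
  proof (intro sum_mono mult_left_mono)
    fix k l assume k: "k \<in> {1..d}"
    let ?A = "multi_indices_section (Suc d) n k l" and ?B = "multi_indices_section d n k l"
    have fib: "{j \<in> J. \<rho> j = i} = {j \<in> ?A. \<rho> j = i}" if "i \<in> ?B" for i
      using that k by (auto simp: multi_indices_section_def J_def \<rho>_def)
    have "sign_mean J (\<lambda>\<theta>. sqrt (\<Sum>i\<in>?B. (b \<theta> i)\<^sup>2)) \<le> sqrt (sign_mean J (\<lambda>\<theta>. \<Sum>i\<in>?B. (b \<theta> i)\<^sup>2))"
      by (rule sign_mean_sqrt_le) (auto simp: fin intro: sum_nonneg)
    also have "sign_mean J (\<lambda>\<theta>. \<Sum>i\<in>?B. (b \<theta> i)\<^sup>2) = (\<Sum>i\<in>?B. \<Sum>j\<in>{j \<in> J. \<rho> j = i}. (a j)\<^sup>2)"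
      unfolding sign_mean_sum b_def by (intro sum.cong refl sign_mean_linear_square) (auto simp: fin)
    also have "\<dots> = (\<Sum>i\<in>?B. \<Sum>j\<in>{j \<in> ?A. \<rho> j = i}. (a j)\<^sup>2)"
      by (simp add: fib)
    also have "\<dots> = (\<Sum>j\<in>?A. (a j)\<^sup>2)"
    proof (rule sum.group)
      show "\<rho> ` ?A \<subseteq> ?B"
        using \<rho> k by (auto simp: multi_indices_section_def J_def I_def \<rho>_def)
    qed (rule finite_multi_indices_section)+
    finally show "sign_mean J (\<lambda>\<theta>. sqrt (\<Sum>i\<in>?B. (b \<theta> i)\<^sup>2)) \<le> sqrt (\<Sum>j\<in>?A. (a j)\<^sup>2)" .
  qed simp
  finally show ?case
    unfolding J_def[symmetric] sec
    by (simp add: sum_distrib_left mult.assoc[symmetric] power_Suc[symmetric] Suc_diff_le del: power_Suc)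
qed

section \<open>The supremum norm as a maximum over sign patterns\<close>

text \<open>
  The signs of \<open>r\<^sub>1, \<dots>, r\<^sub>n\<close> encode the first \<open>n\<close> binary digits of \<open>t\<close>, so each pattern is realised on one
  dyadic interval of length \<open>2 ^ (- n)\<close>. In the induction a further sign selects one half of the interval.
\<close>

lemma rademacher_pattern:
  assumes "\<And>l. s l = 1 \<or> s l = (-1 :: real)"
  shows "\<exists>q :: nat. q < 2 ^ n \<and>
    (\<forall>t \<in> {real q / 2 ^ n ..< (real q + 1) / 2 ^ n}. \<forall>l\<in>{1..n}. rademacher l t = s l)"
proof (induction n)
  case 0
  show ?case by (intro exI[of _ 0]) simp
next
  case (Suc n)
  then obtain q where q: "q < 2 ^ n"
    "\<And>t l. t \<in> {real q / 2 ^ n ..< (real q + 1) / 2 ^ n} \<Longrightarrow> l \<in> {1..n} \<Longrightarrow> rademacher l t = s l"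
    by blast
  define q' where "q' = 2 * q + (if s (Suc n) = 1 then 0 else 1)"
  have "q' < 2 ^ Suc n" using q(1) by (auto simp: q'_def)
  moreover have "rademacher l t = s l"
    if t: "t \<in> {real q' / 2 ^ Suc n ..< (real q' + 1) / 2 ^ Suc n}" and l: "l \<in> {1..Suc n}" for t l
  proof (cases "l = Suc n")
    case True
    have "real q' \<le> 2 ^ Suc n * t" "2 ^ Suc n * t < real q' + 1"
      using t by (auto simp: field_simps)
    then have "\<lfloor>2 ^ Suc n * t\<rfloor> = int q'" by (intro floor_unique) auto
    then show ?thesis
      using True assms[of "Suc n"] by (auto simp: rademacher_def q'_def)
  next
    case False
    have "real q' \<le> 2 ^ Suc n * t" "2 ^ Suc n * t < real q' + 1"
      using t by (auto simp: field_simps)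
    then have "real q \<le> 2 ^ n * t" "2 ^ n * t < real q + 1"
      by (auto simp: q'_def split: if_splits)
    then have "t \<in> {real q / 2 ^ n ..< (real q + 1) / 2 ^ n}"
      by (auto simp: field_simps)
    then show ?thesis using q(2) l False by auto
  qed
  ultimately show ?case by blast
qed

lemma rademacher_cell_positive_measure:
  assumes "\<And>k l. \<epsilon> k l = 1 \<or> \<epsilon> k l = (-1 :: real)"
  obtains Q where "Q \<in> sets (unit_cube_measure d)" "emeasure (unit_cube_measure d) Q > 0"
    "\<And>t k l. t \<in> Q \<Longrightarrow> k \<in> {1..d} \<Longrightarrow> l \<in> {1..n} \<Longrightarrow> rademacher l (t k) = \<epsilon> k l"
proof -
  let ?I = "restrict_space lborel {0..1::real}"
  interpret I: prob_space ?I
    by (rule prob_spaceI) (simp add: emeasure_restrict_space space_restrict_space)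
  interpret product_sigma_finite "\<lambda>_ :: nat. ?I"
    by unfold_locales
  have "\<forall>k. \<exists>q :: nat. q < 2 ^ n \<and>
    (\<forall>t \<in> {real q / 2 ^ n ..< (real q + 1) / 2 ^ n}. \<forall>l\<in>{1..n}. rademacher l t = \<epsilon> k l)"
    by (intro allI rademacher_pattern assms)
  from choice[OF this] obtain q :: "nat \<Rightarrow> nat" where q: "\<And>k. q k < 2 ^ n"
    "\<And>k t l. t \<in> {real (q k) / 2 ^ n ..< (real (q k) + 1) / 2 ^ n} \<Longrightarrow> l \<in> {1..n} \<Longrightarrow> rademacher l t = \<epsilon> k l"
    by blast
  define B where "B k = {real (q k) / 2 ^ n ..< (real (q k) + 1) / 2 ^ n}" for k
  have sub: "B k \<subseteq> {0..1}" for k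
  proof -
    have "q k + 1 \<le> 2 ^ n" using q(1)[of k] by simp
    then have "real (q k) + 1 \<le> 2 ^ n"
      by (metis of_nat_1 of_nat_add of_nat_le_iff of_nat_numeral of_nat_power)
    then have "(real (q k) + 1) / 2 ^ n \<le> 1" "0 \<le> real (q k) / 2 ^ n" by simp_all
    note bounds = this
    show ?thesis
    proof
      fix u assume "u \<in> B k"
      then have "real (q k) / 2 ^ n \<le> u" "u < (real (q k) + 1) / 2 ^ n"
        unfolding B_def by (simp_all only: atLeastLessThan_iff)
      then show "u \<in> {0..1}"
        unfolding atLeastAtMost_iff using bounds by linarith
    qed
  qed
  have sets: "B k \<in> sets ?I" for k
  proof -
    have "B k \<in> sets lborel" by (simp add: B_def)
    then show ?thesis using sub[of k] by (subst sets_restrict_space_iff) auto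
  qed
  have pos: "emeasure ?I (B k) > 0" for k
  proof -
    have "emeasure ?I (B k) = emeasure lborel (B k)"
      using sub[of k] by (intro emeasure_restrict_space) auto
    also have "\<dots> = ennreal (1 / 2 ^ n)"
      by (simp add: B_def divide_right_mono diff_divide_distrib[symmetric])
    finally show ?thesis by simp
  qed
  have "emeasure (unit_cube_measure d) (Pi\<^sub>E {1..d} B) = (\<Prod>k=1..d. emeasure ?I (B k))"
    unfolding unit_cube_measure_def by (rule emeasure_PiM) (auto simp: sets)
  also have "\<dots> > 0"
    using pos by (auto simp: zero_less_iff_neq_zero)
  finally have "emeasure (unit_cube_measure d) (Pi\<^sub>E {1..d} B) > 0" .
  moreover have "Pi\<^sub>E {1..d} B \<in> sets (unit_cube_measure d)"
    unfolding unit_cube_measure_def by (rule sets_PiM_I_finite) (auto simp: sets)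
  moreover have "rademacher l (t k) = \<epsilon> k l" if "t \<in> Pi\<^sub>E {1..d} B" "k \<in> {1..d}" "l \<in> {1..n}" for t k l
    using that PiE_mem[OF that(1,2)] by (intro q(2)) (auto simp: B_def)
  ultimately show thesis by (intro that)
qed

lemma Linf_cube_ge_pattern:
  assumes "\<And>k l. \<epsilon> k l = 1 \<or> \<epsilon> k l = (-1 :: real)"
  shows "\<bar>\<Sum>j\<in>multi_indices d n. a j * (\<Prod>k=1..d. \<epsilon> k (j k))\<bar> \<le> Linf_cube d (multi_rademacher_sum d n a)"
proof (rule ccontr)
  let ?M = "unit_cube_measure d" and ?S = "\<Sum>j\<in>multi_indices d n. a j * (\<Prod>k=1..d. \<epsilon> k (j k))"
  assume less: "\<not> ?thesis"
  obtain Q where Q: "Q \<in> sets ?M" "emeasure ?M Q > 0"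
    "\<And>t k l. t \<in> Q \<Longrightarrow> k \<in> {1..d} \<Longrightarrow> l \<in> {1..n} \<Longrightarrow> rademacher l (t k) = \<epsilon> k l"
    by (rule rademacher_cell_positive_measure[OF assms, where d = d and n = n]) (rule that)
  have val: "multi_rademacher_sum d n a t = ?S" if "t \<in> Q" for t
    unfolding multi_rademacher_sum_def
  proof (rule sum.cong[OF refl])
    fix j assume "j \<in> multi_indices d n"
    then have "j k \<in> {1..n}" if "k \<in> {1..d}" for k
      using that unfolding multi_indices_def by (rule PiE_mem)
    then have "multi_rademacher d j t = (\<Prod>k=1..d. \<epsilon> k (j k))"
      unfolding multi_rademacher_def using Q(3)[OF that] by (intro prod.cong refl) blast
    then show "a j * multi_rademacher d j t = a j * (\<Prod>k=1..d. \<epsilon> k (j k))" by simp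
  qed
  have "AE t in ?M. ereal \<bar>multi_rademacher_sum d n a t\<bar> \<le> ereal (Linf_cube d (multi_rademacher_sum d n a))"
    unfolding esssup_multi_rademacher_sum[symmetric] by (rule esssup_AE)
  then have "AE t in ?M. t \<notin> Q"
    by eventually_elim (use val less in auto)
  then have "emeasure ?M Q = 0"
    using Q(1) sets.sets_into_space[OF Q(1)] by (subst (asm) AE_iff_measurable[OF Q(1)]) auto
  then show False using Q(2) by simp
qed

lemma Linf_cube_le:
  assumes "\<And>t. \<bar>multi_rademacher_sum d n a t\<bar> \<le> c"
  shows "Linf_cube d (multi_rademacher_sum d n a) \<le> c"
proof -
  note [measurable] = measurable_multi_rademacher_sum
  have "ereal (Linf_cube d (multi_rademacher_sum d n a)) \<le> ereal c"
    unfolding esssup_multi_rademacher_sum[symmetric] by (rule esssup_I) (auto simp: assms)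
  then show ?thesis by simp
qed

text \<open>
  The maximum is free of absolute values, because reversing all signs of the first coordinate reverses the
  sign of the sum. This is where \<open>d \<ge> 1\<close> enters: for \<open>d = 0\<close> there is no sign to reverse.
\<close>

lemma Linf_cube_le_MAX_pattern:
  assumes "d \<ge> 1"
  shows "Linf_cube d (multi_rademacher_sum d n a)
    \<le> (MAX \<epsilon>\<in>signs ({1..d} \<times> {1..n}). \<Sum>j\<in>multi_indices d n. a j * (\<Prod>k=1..d. \<epsilon> (k, j k)))"
proof (rule Linf_cube_le)
  fix t
  \<comment> \<open>The pattern at \<open>t\<close>, with the sign of the sum at \<open>t\<close> moved into the first coordinate.\<close>
  define \<sigma> where "\<sigma> = (if multi_rademacher_sum d n a t \<ge> 0 then 1 else -1 :: real)"
  define \<epsilon> where "\<epsilon> = (\<lambda>(k, l). if k \<in> {1..d} \<and> l \<in> {1..n} then (if k = 1 then \<sigma> else 1) * rademacher l (t k) else 1)"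
  have rad: "rademacher l u = 1 \<or> rademacher l u = -1" for l u
    using abs_rademacher[of l u] by linarith
  have sign: "\<epsilon> v = 1 \<or> \<epsilon> v = -1" for v
  proof (cases v)
    case (Pair k l)
    have "\<sigma> = 1 \<or> \<sigma> = -1" by (simp add: \<sigma>_def)
    then show ?thesis
      using rad[of l "t k"] unfolding \<epsilon>_def Pair by (elim disjE) simp_all
  qed
  have \<epsilon>: "\<epsilon> \<in> signs ({1..d} \<times> {1..n})"
  proof (rule signsI[OF sign])
    show "\<epsilon> v = 1" if "v \<notin> {1..d} \<times> {1..n}" for v
      using that by (cases v) (auto simp: \<epsilon>_def)
  qed
  have "(\<Prod>k=1..d. \<epsilon> (k, j k)) = \<sigma> * multi_rademacher d j t" if "j \<in> multi_indices d n" for j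
  proof -
    have "j k \<in> {1..n}" if "k \<in> {1..d}" for k
      using that \<open>j \<in> multi_indices d n\<close> by (auto simp: multi_indices_def)
    then have "(\<Prod>k=1..d. \<epsilon> (k, j k)) = (\<Prod>k=1..d. (if k = 1 then \<sigma> else 1) * rademacher (j k) (t k))"
      by (intro prod.cong) (auto simp: \<epsilon>_def)
    then show ?thesis
      using assms by (simp add: prod.distrib multi_rademacher_def)
  qed
  then have "(\<Sum>j\<in>multi_indices d n. a j * (\<Prod>k=1..d. \<epsilon> (k, j k))) = \<sigma> * multi_rademacher_sum d n a t"
    by (simp add: multi_rademacher_sum_def sum_distrib_left mult_ac)
  also have "\<dots> = \<bar>multi_rademacher_sum d n a t\<bar>"
    by (simp add: \<sigma>_def)
  finally show "\<bar>multi_rademacher_sum d n a t\<bar>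
      \<le> (MAX \<epsilon>\<in>signs ({1..d} \<times> {1..n}). \<Sum>j\<in>multi_indices d n. a j * (\<Prod>k=1..d. \<epsilon> (k, j k)))"
    using MAX_ge[OF finite_signs \<epsilon>, of "\<lambda>\<epsilon>. \<Sum>j\<in>multi_indices d n. a j * (\<Prod>k=1..d. \<epsilon> (k, j k))"] by simp
qed

section \<open>The lower bound\<close>

text \<open>
  The signs of coordinate \<open>k\<close> are chosen as the signs of the inner sums, which do not depend on them.
\<close>

lemma Linf_cube_ge_section:
  assumes "k \<in> {1..d}" and \<epsilon>: "\<And>v. \<epsilon> v = 1 \<or> \<epsilon> v = (-1 :: real)"
  shows "(\<Sum>l=1..n. \<bar>\<Sum>j\<in>multi_indices_section d n k l. a j * (\<Prod>i\<in>{1..d} - {k}. \<epsilon> (i, j i))\<bar>)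
    \<le> Linf_cube d (multi_rademacher_sum d n a)"
proof -
  define Y where "Y l = (\<Sum>j\<in>multi_indices_section d n k l. a j * (\<Prod>i\<in>{1..d} - {k}. \<epsilon> (i, j i)))" for l
  define \<delta> where "\<delta> i l = (if i = k then if Y l \<ge> 0 then 1 else -1 else \<epsilon> (i, l))" for i l
  have "(\<Sum>j\<in>multi_indices d n. a j * (\<Prod>i=1..d. \<delta> i (j i)))
      = (\<Sum>l=1..n. \<Sum>j\<in>multi_indices_section d n k l. a j * (\<Prod>i=1..d. \<delta> i (j i)))"
    unfolding multi_indices_section_def using assms(1)
    by (intro sum.group[symmetric] finite_multi_indices) (auto simp: multi_indices_def)
  also have "\<dots> = (\<Sum>l=1..n. \<bar>Y l\<bar>)"
  proof (rule sum.cong[OF refl])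
    fix l
    have "(\<Sum>j\<in>multi_indices_section d n k l. a j * (\<Prod>i=1..d. \<delta> i (j i)))
        = (\<Sum>j\<in>multi_indices_section d n k l. \<delta> k l * (a j * (\<Prod>i\<in>{1..d} - {k}. \<epsilon> (i, j i))))"
    proof (rule sum.cong[OF refl])
      fix j assume "j \<in> multi_indices_section d n k l"
      then have "j k = l" by (simp add: multi_indices_section_def)
      then have "(\<Prod>i=1..d. \<delta> i (j i)) = \<delta> k l * (\<Prod>i\<in>{1..d} - {k}. \<delta> i (j i))"
        using assms(1) by (simp add: prod.remove)
      also have "(\<Prod>i\<in>{1..d} - {k}. \<delta> i (j i)) = (\<Prod>i\<in>{1..d} - {k}. \<epsilon> (i, j i))"
        by (rule prod.cong[OF refl]) (simp add: \<delta>_def)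
      finally show "a j * (\<Prod>i=1..d. \<delta> i (j i)) = \<delta> k l * (a j * (\<Prod>i\<in>{1..d} - {k}. \<epsilon> (i, j i)))"
        by simp
    qed
    also have "\<dots> = \<delta> k l * Y l"
      by (simp add: Y_def sum_distrib_left)
    also have "\<dots> = \<bar>Y l\<bar>" by (simp add: \<delta>_def)
    finally show "(\<Sum>j\<in>multi_indices_section d n k l. a j * (\<Prod>i=1..d. \<delta> i (j i))) = \<bar>Y l\<bar>" .
  qed
  finally have "(\<Sum>l=1..n. \<bar>Y l\<bar>) \<le> \<bar>\<Sum>j\<in>multi_indices d n. a j * (\<Prod>i=1..d. \<delta> i (j i))\<bar>"
    by simp
  also have "\<dots> \<le> Linf_cube d (multi_rademacher_sum d n a)"
    by (rule Linf_cube_ge_pattern) (use \<epsilon> in \<open>auto simp: \<delta>_def\<close>)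
  finally show ?thesis unfolding Y_def .
qed

lemma Linf_cube_lower_bound:
  assumes k: "k \<in> {1..d}"
  shows "(\<Sum>l=1..n. sqrt (\<Sum>j\<in>multi_indices_section d n k l. (a j)\<^sup>2)) / (4 * 3 ^ (d - 1))
    \<le> Linf_cube d (multi_rademacher_sum d n a)"
proof -
  let ?K = "{1..d} - {k}"
  let ?V = "?K \<times> {1..n}"
  \<comment> \<open>The variables of the monomial of \<open>j\<close> are the points of the graph of \<open>j\<close> off \<open>k\<close>; with \<open>j k = l\<close>
    given, the graph determines \<open>j\<close>, so distinct multi-indices have distinct monomials.\<close>
  define S where "S j = (\<lambda>i. (i, j i)) ` ?K" for j :: "nat \<Rightarrow> nat"
  have inj: "inj_on (\<lambda>i. (i, j i)) ?K" for j :: "nat \<Rightarrow> nat"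
    by (auto simp: inj_on_def)
  have walsh_S: "walsh (S j) \<epsilon> = (\<Prod>i\<in>?K. \<epsilon> (i, j i))" for j \<epsilon>
    unfolding walsh_def S_def by (subst prod.reindex[OF inj]) simp
  have "(\<Sum>l=1..n. sqrt (\<Sum>j\<in>multi_indices_section d n k l. (a j)\<^sup>2)) / (4 * 3 ^ (d - 1))
      = (\<Sum>l=1..n. sqrt (\<Sum>j\<in>multi_indices_section d n k l. (a j)\<^sup>2) / (4 * 3 ^ (d - 1)))"
    by (simp add: sum_divide_distrib)
  also have "\<dots> \<le> (\<Sum>l=1..n. sign_mean ?V (\<lambda>\<epsilon>. \<bar>\<Sum>j\<in>multi_indices_section d n k l. a j * walsh (S j) \<epsilon>\<bar>))"
  proof (intro sum_mono walsh_khintchine)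
    fix l
    show "inj_on S (multi_indices_section d n k l)"
    proof (rule inj_onI)
      fix j j' assume *: "j \<in> multi_indices_section d n k l" "j' \<in> multi_indices_section d n k l" "S j = S j'"
      have "j i = j' i" if "i \<in> {1..d}" for i
      proof (cases "i = k")
        case True
        then show ?thesis using * by (simp add: multi_indices_section_def)
      next
        case False
        then have "(i, j i) \<in> S j" using that by (auto simp: S_def)
        then have "(i, j i) \<in> S j'" using *(3) by simp
        then show ?thesis by (auto simp: S_def)
      qed
      moreover have "j \<in> {1..d} \<rightarrow>\<^sub>E {1..n}" "j' \<in> {1..d} \<rightarrow>\<^sub>E {1..n}"
        using *(1,2) by (simp_all add: multi_indices_section_def multi_indices_def)
      ultimately show "j = j'" by (intro PiE_ext)
    qed
    fix j assume "j \<in> multi_indices_section d n k l"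
    then show "S j \<subseteq> ?V"
      by (auto simp: S_def multi_indices_section_def multi_indices_def)
    show "card (S j) \<le> d - 1"
      unfolding S_def card_image[OF inj] using k by simp
  qed (auto simp: finite_multi_indices_section)
  also have "\<dots> = sign_mean ?V (\<lambda>\<epsilon>. \<Sum>l=1..n. \<bar>\<Sum>j\<in>multi_indices_section d n k l. a j * walsh (S j) \<epsilon>\<bar>)"
    by (simp add: sign_mean_sum)
  also have "\<dots> \<le> sign_mean ?V (\<lambda>_. Linf_cube d (multi_rademacher_sum d n a))"
    unfolding walsh_S by (intro sign_mean_mono Linf_cube_ge_section k signs_value)
  also have "\<dots> = Linf_cube d (multi_rademacher_sum d n a)"
    by (simp add: sign_mean_const)
  finally show ?thesis .
qed

section \<open>Random unconditional convergence\<close>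

text \<open>
  The two descriptions of sign families differ only outside \<open>multi_indices d n\<close>, where \<open>F\<close> does not look.
\<close>

lemma sign_expectation_eq_sign_mean:
  assumes "\<And>\<theta> \<theta>'. (\<And>j. j \<in> multi_indices d n \<Longrightarrow> \<theta> j = \<theta>' j) \<Longrightarrow> F \<theta> = F \<theta>'"
  shows "sign_expectation d n F = sign_mean (multi_indices d n) F"
proof -
  let ?J = "multi_indices d n"
  let ?ext = "\<lambda>\<theta> j. if j \<in> ?J then \<theta> j else 1 :: real"
  have bij: "bij_betw (\<lambda>\<theta>. restrict \<theta> ?J) (signs ?J) (sign_arrangements d n)"
  proof (rule bij_betw_byWitness[where f' = ?ext])
    show "\<forall>\<theta>\<in>signs ?J. ?ext (restrict \<theta> ?J) = \<theta>"
    proof (intro ballI ext)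
      fix \<theta> j assume "\<theta> \<in> signs ?J"
      then show "?ext (restrict \<theta> ?J) j = \<theta> j"
        using signs_outside[of \<theta> ?J j] by simp
    qed
    show "\<forall>\<theta>\<in>sign_arrangements d n. restrict (?ext \<theta>) ?J = \<theta>"
    proof
      fix \<theta> assume "\<theta> \<in> sign_arrangements d n"
      then have "restrict \<theta> ?J = \<theta>" unfolding sign_arrangements_def by (rule PiE_restrict)
      moreover have "restrict (?ext \<theta>) ?J = restrict \<theta> ?J" by (rule restrict_ext) simp
      ultimately show "restrict (?ext \<theta>) ?J = \<theta>" by simp
    qed
    show "(\<lambda>\<theta>. restrict \<theta> ?J) ` signs ?J \<subseteq> sign_arrangements d n"
    proof
      fix \<eta> assume "\<eta> \<in> (\<lambda>\<theta>. restrict \<theta> ?J) ` signs ?J"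
      then obtain \<theta> where \<theta>: "\<theta> \<in> signs ?J" "\<eta> = restrict \<theta> ?J" by blast
      show "\<eta> \<in> sign_arrangements d n"
        unfolding \<theta>(2) sign_arrangements_def
      proof (rule restrict_PiE_iff[THEN iffD2], rule ballI)
        show "\<theta> j \<in> {-1, 1}" for j
          using signs_value[OF \<theta>(1), of j] by auto
      qed
    qed
    show "?ext ` sign_arrangements d n \<subseteq> signs ?J"
    proof
      fix \<eta> assume "\<eta> \<in> ?ext ` sign_arrangements d n"
      then obtain \<theta> where \<theta>: "\<theta> \<in> sign_arrangements d n" "\<eta> = ?ext \<theta>" by blast
      show "\<eta> \<in> signs ?J"
      proof (rule signsI)
        show "\<eta> j = 1 \<or> \<eta> j = -1" for j
          using \<theta>(1) PiE_mem[of \<theta> ?J "\<lambda>_. {-1, 1}" j] unfolding \<theta>(2) sign_arrangements_def by auto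
      qed (simp add: \<theta>(2))
    qed
  qed
  have "(\<Sum>\<theta>\<in>sign_arrangements d n. F \<theta>) = (\<Sum>\<theta>\<in>signs ?J. F (restrict \<theta> ?J))"
    using sum.reindex_bij_betw[OF bij, of F] by simp
  also have "\<dots> = (\<Sum>\<theta>\<in>signs ?J. F \<theta>)"
    by (intro sum.cong refl assms) simp
  finally show ?thesis
    using bij_betw_same_card[OF bij] by (simp add: sign_expectation_eq_average sign_mean_def)
qed

lemma sign_expectation_Linf_cube_upper_bound:
  assumes "d \<ge> 1"
  shows "sign_expectation d n (\<lambda>\<theta>. Linf_cube d (multi_rademacher_sum d n (\<lambda>j. a j * \<theta> j)))
    \<le> (\<Sum>k=1..d. 2 ^ (d - k) * (\<Sum>l=1..n. sqrt (\<Sum>j\<in>multi_indices_section d n k l. (a j)\<^sup>2)))"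
proof -
  let ?T = "signs ({1..d} \<times> {1..n})"
  have "sign_expectation d n (\<lambda>\<theta>. Linf_cube d (multi_rademacher_sum d n (\<lambda>j. a j * \<theta> j)))
      = sign_mean (multi_indices d n) (\<lambda>\<theta>. Linf_cube d (multi_rademacher_sum d n (\<lambda>j. a j * \<theta> j)))"
    by (rule sign_expectation_eq_sign_mean) (simp add: multi_rademacher_sum_def[abs_def])
  also have "\<dots> \<le> sign_mean (multi_indices d n)
      (\<lambda>\<theta>. MAX \<epsilon>\<in>?T. \<Sum>j\<in>multi_indices d n. a j * \<theta> j * (\<Prod>k=1..d. \<epsilon> (k, j k)))"
    by (intro sign_mean_mono Linf_cube_le_MAX_pattern assms)
  also have "\<dots> \<le> (\<Sum>k=1..d. 2 ^ (d - k) * (\<Sum>l=1..n. sqrt (\<Sum>j\<in>multi_indices_section d n k l. (a j)\<^sup>2)))"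
  proof (rule sign_mean_MAX_multi_sum)
    show "\<bar>\<epsilon> (k, l)\<bar> = 1" if "\<epsilon> \<in> ?T" for \<epsilon> k l
      using that by (rule signs_abs)
  qed (simp_all add: finite_signs signs_nonempty)
  finally show ?thesis .
qed

theorem theorem4:
  fixes d :: nat
  assumes "d \<ge> 1"
  shows
    "(\<exists>C > 0. \<forall>n \<ge> 1. \<forall>a :: (nat \<Rightarrow> nat) \<Rightarrow> real.
        sign_expectation d n (\<lambda>\<theta>. Linf_cube d (multi_rademacher_sum d n (\<lambda>j. \<theta> j * a j)))
          \<le> C * Linf_cube d (multi_rademacher_sum d n a)) \<and>
     (\<exists>c > 0. \<forall>n \<ge> 1. \<forall>a :: (nat \<Rightarrow> nat) \<Rightarrow> real.
        Linf_cube d (multi_rademacher_sum d n a)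
          \<ge> c * (MAX k \<in> {1..d}. \<Sum>l = 1..n. sqrt (\<Sum>j \<in> multi_indices_section d n k l. (a j)\<^sup>2))) \<and>
     (\<forall>n \<ge> 1. \<forall>a :: (nat \<Rightarrow> nat) \<Rightarrow> real.
        sign_expectation d n (\<lambda>\<theta>. Linf_cube d (multi_rademacher_sum d n (\<lambda>j. a j * \<theta> j)))
          \<le> (\<Sum>k = 1..d. 2 ^ (d - k) * (\<Sum>l = 1..n. sqrt (\<Sum>j \<in> multi_indices_section d n k l. (a j)\<^sup>2))))"
proof (intro conjI)
  define K :: real where "K = 4 * 3 ^ (d - 1)"
  define R where "R n a k = (\<Sum>l=1..n. sqrt (\<Sum>j\<in>multi_indices_section d n k l. (a j)\<^sup>2))"
    for n k and a :: "(nat \<Rightarrow> nat) \<Rightarrow> real"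
  have "K > 0" by (simp add: K_def)
  have lower: "R n a k \<le> K * Linf_cube d (multi_rademacher_sum d n a)" if "k \<in> {1..d}" for n a k
    using Linf_cube_lower_bound[OF that, where n = n and a = a] by (simp add: R_def K_def field_simps)
  have upper: "sign_expectation d n (\<lambda>\<theta>. Linf_cube d (multi_rademacher_sum d n (\<lambda>j. a j * \<theta> j)))
      \<le> (\<Sum>k=1..d. 2 ^ (d - k) * R n a k)" for n a
    unfolding R_def using assms by (rule sign_expectation_Linf_cube_upper_bound)
  show "\<exists>C > 0. \<forall>n \<ge> 1. \<forall>a :: (nat \<Rightarrow> nat) \<Rightarrow> real.
        sign_expectation d n (\<lambda>\<theta>. Linf_cube d (multi_rademacher_sum d n (\<lambda>j. \<theta> j * a j)))
          \<le> C * Linf_cube d (multi_rademacher_sum d n a)"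
  proof (intro exI[of _ "(\<Sum>k=1..d. 2 ^ (d - k)) * K"] conjI allI impI)
    have "(\<Sum>k=1..d. 2 ^ (d - k) :: real) > 0"
      using assms by (intro sum_pos) auto
    then show "0 < (\<Sum>k=1..d. 2 ^ (d - k)) * K" using \<open>K > 0\<close> by simp
    fix n and a :: "(nat \<Rightarrow> nat) \<Rightarrow> real"
    have "(\<Sum>k=1..d. 2 ^ (d - k) * R n a k)
        \<le> (\<Sum>k=1..d. 2 ^ (d - k) * (K * Linf_cube d (multi_rademacher_sum d n a)))"
      by (intro sum_mono mult_left_mono lower) auto
    also have "\<dots> = (\<Sum>k=1..d. 2 ^ (d - k)) * K * Linf_cube d (multi_rademacher_sum d n a)"
      by (simp only: sum_distrib_right mult.assoc)
    finally show "sign_expectation d n (\<lambda>\<theta>. Linf_cube d (multi_rademacher_sum d n (\<lambda>j. \<theta> j * a j)))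
          \<le> (\<Sum>k=1..d. 2 ^ (d - k)) * K * Linf_cube d (multi_rademacher_sum d n a)"
      using upper[of n a] by (simp only: mult.commute[of "a _"])
  qed
  show "\<exists>c > 0. \<forall>n \<ge> 1. \<forall>a :: (nat \<Rightarrow> nat) \<Rightarrow> real.
        Linf_cube d (multi_rademacher_sum d n a)
          \<ge> c * (MAX k \<in> {1..d}. \<Sum>l = 1..n. sqrt (\<Sum>j \<in> multi_indices_section d n k l. (a j)\<^sup>2))"
  proof (intro exI[of _ "1 / K"] conjI allI impI)
    fix n and a :: "(nat \<Rightarrow> nat) \<Rightarrow> real"
    have "(MAX k\<in>{1..d}. R n a k) \<le> K * Linf_cube d (multi_rademacher_sum d n a)"
      using assms by (intro MAX_le lower) auto
    then show "1 / K * (MAX k \<in> {1..d}. \<Sum>l = 1..n. sqrt (\<Sum>j \<in> multi_indices_section d n k l. (a j)\<^sup>2))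
        \<le> Linf_cube d (multi_rademacher_sum d n a)"
      using \<open>K > 0\<close> by (simp add: R_def field_simps)
  qed (use \<open>K > 0\<close> in simp)
  show "\<forall>n \<ge> 1. \<forall>a :: (nat \<Rightarrow> nat) \<Rightarrow> real.
        sign_expectation d n (\<lambda>\<theta>. Linf_cube d (multi_rademacher_sum d n (\<lambda>j. a j * \<theta> j)))
          \<le> (\<Sum>k = 1..d. 2 ^ (d - k) * (\<Sum>l = 1..n. sqrt (\<Sum>j \<in> multi_indices_section d n k l. (a j)\<^sup>2)))"
    using upper unfolding R_def by blast
qed

end
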